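(* Assume that $$c_0 > 3\alpha_m,\qquad C_d > 3\alpha_m\theta_0,$$ and $$L \ge 2\delta \quad\text{for some } \delta \ge \tfrac12 .$$ Furthermore, assume that the M-ROM online stage employs a Galerkin projection onto the reduced basis spaces $\boldsymbol{V}_r,W_r,\Theta_r$ associated to FS-ROM (all defined in the context). For a fixed $n+1$, assume that the FS-ROM solution at time step $n+1$ is initialized to the M-ROM solution at time step $n$, i.e. $$\boldsymbol{u}_r^{n+1,0}=\boldsymbol{u}_r^{n},\qquad p_r^{n+1,0}=p_r^{n},\qquad \theta_r^{n+1,0}=\theta_r^{n}.$$ Then the FS-ROM solution converges to the solution of the M-ROM method: $$\|\boldsymbol{u}_r^{n+1,i}-\boldsymbol{u}_r^{n+1}\|_1\to 0,\qquad \|p_r^{n+1,i}-p_r^{n+1}\|\to 0,\qquad \|\theta_r^{n+1,i}-\theta_r^{n+1}\|\to 0$$ as $i\to\infty$.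
   Context: Setting. $\Omega\subset\mathbb{R}^d$, $d\in\{2,3\}$, is a bounded connected Lipschitz domain; $(\cdot,\cdot)$ and $\|\cdot\|$ are the $L^2(\Omega)$ inner product and norm (for scalar, vector or tensor fields), and $(\cdot,\cdot)_1$, $\|\cdot\|_1$ are the full $H^1(\Omega)$ inner product and norm. $\varepsilon(\boldsymbol{v})=\frac12(\nabla\boldsymbol{v}+(\nabla\boldsymbol{v})^T)$. The unknowns are the displacement $\boldsymbol{u}$, the fluid pressure $p$ and the temperature $\theta$ of a linear thermo-poroelasticity model with homogeneous Dirichlet boundary conditions for all three variables. Parameters. The Lamé constants satisfy $\mu\in[\mu_0,\mu_1]$ with $0<\mu_0<\mu_1<\infty$ and $\lambda\in[0,\infty)$; $K_{dr}=(d\lambda+2\mu)/d$ is the drained isothermal bulk modulus. The physical constants are: $\alpha$, the Biot-Willis constant; $c_0=1/M$, where $M$ is Biot's modulus; $\alpha_T$, the volumetric skeleton thermal dilation coefficient; $3\alpha_m$, the thermal dilation coefficient; $C_d$, the effective total heat conductivity; and $\theta_0$, a reference temperature, assumed to be nonzero. $L>0$ is a stabilization coefficient. The permeability tensor $\boldsymbol{K}$ and the bulk thermal conductivity tensor $\boldsymbol{D}$ are symmetric $d\times d$ tensors on $\Omega$, and there are positive constants $k_{\min},k_{\max},d_{\min},d_{\max}$ with $k_{\min}\xi^T\xi\le \xi^T\boldsymbol{K}(x)\xi\le k_{\max}\xi^T\xi$ and $d_{\min}\xi^T\xi\le \xi^T\boldsymbol{D}(x)\xi\le d_{\max}\xi^T\xi$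 for all $x\in\Omega$, $\xi\in\mathbb{R}^d$. $\Delta t>0$ is the time step, $t^n=n\Delta t$, $n=0,\dots,N$, $t^N=T$. The body force $\mathbf{f}$, the fluid source $g$ and the heat source $\eta$ are given, and $\mathbf{f}^{n+1},g^{n+1},\eta^{n+1}$ are their values at $t^{n+1}$. $\boldsymbol{V}_h,W_h,\Theta_h$ are finite-dimensional (continuous Galerkin finite element) subspaces of $[H^1_0(\Omega)]^d$, $H^1_0(\Omega)$, $H^1_0(\Omega)$, respectively, on a shape-regular triangulation of $\Omega$. Fixed-stress iteration on a triple of spaces. For finite-dimensional spaces $\boldsymbol{V}\subset[H^1_0(\Omega)]^d$, $W,\Theta\subset H^1_0(\Omega)$, a triple $(\boldsymbol{u}^n,p^n,\theta^n)\in\boldsymbol{V}\times W\times\Theta$ and an initialization $(\boldsymbol{u}^{n+1,0},p^{n+1,0},\theta^{n+1,0})\in\boldsymbol{V}\times W\times\Theta$, the fixed-stress iteration at time step $n+1$ is, for $i=0,1,2,\dots$: Step 1: find $p^{n+1,i+1}\in W$ such that for all $w\in W$ $$c_0\Big(\tfrac{p^{n+1,i+1}-p^n}{\Delta t},w\Big)+(\boldsymbol{K}\nabla p^{n+1,i+1},\nabla w)+L\tfrac{\alpha^2}{K_{dr}}\Big(\tfrac{p^{n+1,i+1}-p^{n+1,i}}{\Delta t},w\Big)=(g^{n+1},w)-\alpha\Big(\nabla\cdot\tfrac{\boldsymbol{u}^{n+1,i}-\boldsymbol{u}^n}{\Delta t},w\Big)+3\alpha_m\Big(\tfrac{\theta^{n+1,i}-\theta^n}{\Delta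 t},w\Big).$$ Step 2: find $\theta^{n+1,i+1}\in\Theta$ such that for all $s\in\Theta$ $$C_d\Big(\tfrac{\theta^{n+1,i+1}-\theta^n}{\Delta t},s\Big)+(\boldsymbol{D}\nabla\theta^{n+1,i+1},\nabla s)+9L\alpha_T^2K_{dr}\theta_0\Big(\tfrac{\theta^{n+1,i+1}-\theta^{n+1,i}}{\Delta t},s\Big)=(\eta^{n+1},s)+3\alpha_m\theta_0\Big(\tfrac{p^{n+1,i}-p^n}{\Delta t},s\Big)-3\alpha_TK_{dr}\theta_0\Big(\nabla\cdot\tfrac{\boldsymbol{u}^{n+1,i}-\boldsymbol{u}^n}{\Delta t},s\Big).$$ Step 3: find $\boldsymbol{u}^{n+1,i+1}\in\boldsymbol{V}$ such that for all $\boldsymbol{v}\in\boldsymbol{V}$ $$2\mu(\varepsilon(\boldsymbol{u}^{n+1,i+1}),\varepsilon(\boldsymbol{v}))+\lambda(\nabla\cdot\boldsymbol{u}^{n+1,i+1},\nabla\cdot\boldsymbol{v})=(\mathbf{f}^{n+1},\boldsymbol{v})+\alpha(p^{n+1,i+1},\nabla\cdot\boldsymbol{v})+3\alpha_TK_{dr}(\theta^{n+1,i+1},\nabla\cdot\boldsymbol{v}).$$ Reduced basis spaces associated to FS-ROM. FS-HF (fixed-stress high-fidelity) denotes the fixed-stress iteration with $(\boldsymbol{V},W,\Theta)=(\boldsymbol{V}_h,W_h,\Theta_h)$. It is run in time to obtain $\{\boldsymbol{u}_h^{n,\infty}\}_{n=0}^N$, $\{p_h^{n,\infty}\}_{n=0}^N$,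 $\{\theta_h^{n,\infty}\}_{n=0}^N$, where the superscript $n,\infty$ denotes the converged solutions at time step $n$. To each of these three sequences, written $\{\phi^n\}_{n=0}^N$, proper orthogonal decomposition (POD) is applied: one forms the matrix $\mathbf{C}\in\mathbb{R}^{(N+1)\times(N+1)}$, $\mathbf{C}_{nm}=(\phi^n,\phi^m)_1$, which is symmetric positive definite by construction, with eigenvalues sorted in decreasing order $\nu_0\ge\nu_1\ge\dots\ge\nu_N>0$ and orthonormal eigenvectors $v_0,\dots,v_N$, and the modes $\varphi_k=\nu_k^{-1/2}\sum_{\beta=0}^N[v_k]_\beta\,\phi^\beta$. For a chosen $r\le N$, the reduced basis space is the span of the first $r$ modes. The spaces so obtained from the displacement, pressure and temperature sequences are $\boldsymbol{V}_r\subset\boldsymbol{V}_h$, $W_r\subset W_h$, $\Theta_r\subset\Theta_h$; these are the reduced basis spaces associated to FS-ROM. M-ROM (monolithic reduced order model), with Galerkin projection onto these spaces. Given $(\boldsymbol{u}_r^n,p_r^n,\theta_r^n)\in\boldsymbol{V}_r\times W_r\times\Theta_r$, the M-ROM solution at step $n+1$ is $(\boldsymbol{u}_r^{n+1},p_r^{n+1},\theta_r^{n+1})\in\boldsymbol{V}_r\times W_r\times\Theta_r$ such that for all $(\boldsymbol{v},w,s)\in\boldsymbol{V}_r\times W_r\times\Theta_r$: $$2\mu(\varepsilon(\boldsymbol{u}_r^{n+1}),\varepsilon(\boldsymbol{v}))+\lambda(\nabla\cdot\boldsymbol{u}_r^{n+1},\nabla\cdot\boldsymbol{v})-\alpha(p_r^{n+1},\nabla\cdot\boldsymbol{v})-3\alpha_TK_{dr}(\theta_r^{n+1},\nabla\cdot\boldsymbol{v})=(\mathbf{f}^{n+1},\boldsymbol{v}),$$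 $$c_0\Big(\tfrac{p_r^{n+1}-p_r^n}{\Delta t},w\Big)+\alpha\Big(\tfrac{\nabla\cdot\boldsymbol{u}_r^{n+1}-\nabla\cdot\boldsymbol{u}_r^n}{\Delta t},w\Big)-3\alpha_m\Big(\tfrac{\theta_r^{n+1}-\theta_r^n}{\Delta t},w\Big)+(\boldsymbol{K}\nabla p_r^{n+1},\nabla w)=(g^{n+1},w),$$ $$C_d\Big(\tfrac{\theta_r^{n+1}-\theta_r^n}{\Delta t},s\Big)+3\alpha_TK_{dr}\theta_0\Big(\tfrac{\nabla\cdot\boldsymbol{u}_r^{n+1}-\nabla\cdot\boldsymbol{u}_r^n}{\Delta t},s\Big)-3\alpha_m\theta_0\Big(\tfrac{p_r^{n+1}-p_r^n}{\Delta t},s\Big)+(\boldsymbol{D}\nabla\theta_r^{n+1},\nabla s)=(\eta^{n+1},s).$$ FS-ROM (fixed-stress reduced order model). The FS-ROM solution at time step $n+1$ is the sequence of iterates $(\boldsymbol{u}_r^{n+1,i},p_r^{n+1,i},\theta_r^{n+1,i})$ of the fixed-stress iteration above with $(\boldsymbol{V},W,\Theta)=(\boldsymbol{V}_r,W_r,\Theta_r)$ and $(\boldsymbol{u}^n,p^n,\theta^n)=(\boldsymbol{u}_r^n,p_r^n,\theta_r^n)$, the same triple as in M-ROM.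
   Formalization: The reference temperature θ_0 is assumed positive (not just nonzero) and α_m is assumed nonnegative; the claim fails for some θ_0<0 with large L, and for very negative α_m, where the conditions c_0>3α_m and C_d>3α_mθ_0 are vacuous. *)

theory Defs
  imports "HOL-Analysis.Analysis"
begin

section \<open>Lipschitz domains\<close>

text \<open>
  Near each boundary point, after a rigid change of coordinates with vertical unit vector \<open>e\<close>,
  the set is the strict epigraph of a Lipschitz function \<open>\<gamma>\<close> of the horizontal
  component \<open>y - (y \<bullet> e) e\<close>.
\<close>

definition lipschitz_boundary :: "(real^'d::finite) set \<Rightarrow> bool" where
  "lipschitz_boundary \<Omega> \<longleftrightarrow>
     (\<forall>x\<in>frontier \<Omega>. \<exists>r>0. \<exists>e C. \<exists>\<gamma> :: real^'d \<Rightarrow> real.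
        norm e = 1 \<and> C-lipschitz_on {z. z \<bullet> e = 0} \<gamma> \<and>
        \<Omega> \<inter> ball x r = {y \<in> ball x r. \<gamma> (y - (y \<bullet> e) *\<^sub>R e) < y \<bullet> e})"

definition bounded_lipschitz_domain :: "(real^'d::finite) set \<Rightarrow> bool" where
  "bounded_lipschitz_domain \<Omega> \<longleftrightarrow>
     \<Omega> \<noteq> {} \<and> open \<Omega> \<and> connected \<Omega> \<and> bounded \<Omega> \<and> lipschitz_boundary \<Omega>"


section \<open>Lebesgue and Sobolev spaces\<close>

text \<open>
  Elements of \<open>L\<^sup>2\<close> and \<open>H\<^sup>1\<close> are represented by functions on the whole of
  \<open>\<real>\<^sup>d\<close>; only their values in \<open>\<Omega>\<close>, up to null sets, enter the inner products. One
  inner product serves for scalar, vector and tensor fields, because \<open>\<bullet>\<close> on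
  \<^typ>\<open>real^'d^'d\<close> is the Frobenius product.
\<close>

definition L2 :: "(real^'d::finite) set \<Rightarrow> (real^'d \<Rightarrow> 'b::euclidean_space) set" where
  "L2 \<Omega> = {f. f \<in> borel_measurable (lebesgue_on \<Omega>) \<and>
               integrable (lebesgue_on \<Omega>) (\<lambda>x. (norm (f x))\<^sup>2)}"

definition l2_inner ::
    "(real^'d::finite) set \<Rightarrow> (real^'d \<Rightarrow> 'b::euclidean_space) \<Rightarrow> (real^'d \<Rightarrow> 'b) \<Rightarrow> real" where
  "l2_inner \<Omega> f g = (LINT x|lebesgue_on \<Omega>. f x \<bullet> g x)"

definition l2_norm :: "(real^'d::finite) set \<Rightarrow> (real^'d \<Rightarrow> 'b::euclidean_space) \<Rightarrow> real" where
  "l2_norm \<Omega> f = sqrt (l2_inner \<Omega> f f)"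

definition grad :: "(real^'d::finite \<Rightarrow> real) \<Rightarrow> real^'d \<Rightarrow> real^'d" where
  "grad f x = (\<chi> i. frechet_derivative f (at x) (axis i 1))"

primrec k_times_cont_diff :: "nat \<Rightarrow> (real^'d::finite \<Rightarrow> real) \<Rightarrow> bool" where
  "k_times_cont_diff 0 f \<longleftrightarrow> continuous_on UNIV f"
| "k_times_cont_diff (Suc k) f \<longleftrightarrow>
     (\<forall>x. f differentiable at x) \<and> (\<forall>i. k_times_cont_diff k (\<lambda>x. grad f x $ i))"

definition test_functions :: "(real^'d::finite) set \<Rightarrow> (real^'d \<Rightarrow> real) set" where
  "test_functions \<Omega> =
     {\<phi>. (\<forall>k. k_times_cont_diff k \<phi>) \<and> (\<exists>S. compact S \<and> S \<subseteq> \<Omega> \<and> (\<forall>x. x \<notin> S \<longrightarrow> \<phi> x = 0))}"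

definition is_weak_grad ::
    "(real^'d::finite) set \<Rightarrow> (real^'d \<Rightarrow> real) \<Rightarrow> (real^'d \<Rightarrow> real^'d) \<Rightarrow> bool" where
  "is_weak_grad \<Omega> u g \<longleftrightarrow> g \<in> L2 \<Omega> \<and>
     (\<forall>\<phi>\<in>test_functions \<Omega>. \<forall>i.
        l2_inner \<Omega> u (\<lambda>x. grad \<phi> x $ i) = - l2_inner \<Omega> (\<lambda>x. g x $ i) \<phi>)"

definition H1 :: "(real^'d::finite) set \<Rightarrow> (real^'d \<Rightarrow> real) set" where
  "H1 \<Omega> = {u \<in> L2 \<Omega>. \<exists>g. is_weak_grad \<Omega> u g}"

text \<open>The weak gradient is unique up to null sets, so the choice of representative is immaterial.\<close>

definition wgrad :: "(real^'d::finite) set \<Rightarrow> (real^'d \<Rightarrow> real) \<Rightarrow> real^'d \<Rightarrow> real^'d" where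
  "wgrad \<Omega> u = (SOME g. is_weak_grad \<Omega> u g)"

text \<open>The closure of the test functions in \<open>H\<^sup>1\<close>.\<close>

definition H10 :: "(real^'d::finite) set \<Rightarrow> (real^'d \<Rightarrow> real) set" where
  "H10 \<Omega> = {u \<in> H1 \<Omega>. \<exists>\<psi>. (\<forall>k. \<psi> k \<in> test_functions \<Omega>) \<and>
      (\<lambda>k. l2_norm \<Omega> (\<lambda>x. \<psi> k x - u x)) \<longlonglongrightarrow> 0 \<and>
      (\<lambda>k. l2_norm \<Omega> (\<lambda>x. grad (\<psi> k) x - wgrad \<Omega> u x)) \<longlonglongrightarrow> 0}"

definition H10v :: "(real^'d::finite) set \<Rightarrow> (real^'d \<Rightarrow> real^'d) set" where
  "H10v \<Omega> = {u. \<forall>i. (\<lambda>x. u x $ i) \<in> H10 \<Omega>}"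

text \<open>Row \<open>i\<close> of the weak Jacobian is the weak gradient of the \<open>i\<close>-th component.\<close>

definition wjac :: "(real^'d::finite) set \<Rightarrow> (real^'d \<Rightarrow> real^'d) \<Rightarrow> real^'d \<Rightarrow> real^'d^'d" where
  "wjac \<Omega> u x = (\<chi> i. wgrad \<Omega> (\<lambda>y. u y $ i) x)"

definition wdiv :: "(real^'d::finite) set \<Rightarrow> (real^'d \<Rightarrow> real^'d) \<Rightarrow> real^'d \<Rightarrow> real" where
  "wdiv \<Omega> u x = trace (wjac \<Omega> u x)"

definition strain :: "(real^'d::finite) set \<Rightarrow> (real^'d \<Rightarrow> real^'d) \<Rightarrow> real^'d \<Rightarrow> real^'d^'d" where
  "strain \<Omega> u x = (1/2) *\<^sub>R (wjac \<Omega> u x + transpose (wjac \<Omega> u x))"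

definition h1_inner ::
    "(real^'d::finite) set \<Rightarrow> (real^'d \<Rightarrow> real) \<Rightarrow> (real^'d \<Rightarrow> real) \<Rightarrow> real" where
  "h1_inner \<Omega> p q = l2_inner \<Omega> p q + l2_inner \<Omega> (wgrad \<Omega> p) (wgrad \<Omega> q)"

definition h1v_inner ::
    "(real^'d::finite) set \<Rightarrow> (real^'d \<Rightarrow> real^'d) \<Rightarrow> (real^'d \<Rightarrow> real^'d) \<Rightarrow> real" where
  "h1v_inner \<Omega> u v = l2_inner \<Omega> u v + l2_inner \<Omega> (wjac \<Omega> u) (wjac \<Omega> v)"

definition h1v_norm :: "(real^'d::finite) set \<Rightarrow> (real^'d \<Rightarrow> real^'d) \<Rightarrow> real" where
  "h1v_norm \<Omega> u = sqrt (h1v_inner \<Omega> u u)"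


section \<open>Finite-dimensional function spaces and proper orthogonal decomposition\<close>

definition lin_span :: "nat \<Rightarrow> (nat \<Rightarrow> 'a \<Rightarrow> 'b::real_vector) \<Rightarrow> ('a \<Rightarrow> 'b) set" where
  "lin_span m b = {f. \<exists>c :: nat \<Rightarrow> real. f = (\<lambda>x. \<Sum>k<m. c k *\<^sub>R b k x)}"

definition fin_dim_space :: "('a \<Rightarrow> 'b::real_vector) set \<Rightarrow> bool" where
  "fin_dim_space V \<longleftrightarrow> (\<exists>m b. V = lin_span m b)"

definition pod_matrix :: "('f \<Rightarrow> 'f \<Rightarrow> real) \<Rightarrow> (nat \<Rightarrow> 'f) \<Rightarrow> nat \<Rightarrow> nat \<Rightarrow> real" where
  "pod_matrix ip \<phi> n m = ip (\<phi> n) (\<phi> m)"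

definition pod_mode ::
    "nat \<Rightarrow> (nat \<Rightarrow> 'a \<Rightarrow> 'b::real_vector) \<Rightarrow> (nat \<Rightarrow> real) \<Rightarrow> (nat \<Rightarrow> nat \<Rightarrow> real) \<Rightarrow> nat \<Rightarrow> 'a \<Rightarrow> 'b" where
  "pod_mode N \<phi> \<nu> v k = (\<lambda>x. (1 / sqrt (\<nu> k)) *\<^sub>R (\<Sum>\<beta>\<le>N. v k \<beta> *\<^sub>R \<phi> \<beta> x))"

text \<open>
  \<open>S\<close> is a reduced basis space of dimension \<open>r\<close> obtained from the snapshots
  \<open>\<phi> 0, \<dots>, \<phi> N\<close> with respect to the inner product \<open>ip\<close>. It is a relation rather
  than a function, because the orthonormal eigenvectors \<open>v k\<close> are not unique.
\<close>

definition pod_space ::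
    "(('a \<Rightarrow> 'b::real_vector) \<Rightarrow> ('a \<Rightarrow> 'b) \<Rightarrow> real) \<Rightarrow> nat \<Rightarrow> (nat \<Rightarrow> 'a \<Rightarrow> 'b) \<Rightarrow> nat \<Rightarrow> ('a \<Rightarrow> 'b) set \<Rightarrow> bool"
  where
  "pod_space ip N \<phi> r S \<longleftrightarrow> (\<exists>\<nu> v.
     (\<forall>k\<le>N. \<forall>n\<le>N. (\<Sum>m\<le>N. pod_matrix ip \<phi> n m * v k m) = \<nu> k * v k n) \<and>
     (\<forall>k\<le>N. \<forall>l\<le>N. (\<Sum>m\<le>N. v k m * v l m) = (if k = l then 1 else 0)) \<and>
     (\<forall>k l. k \<le> l \<longrightarrow> l \<le> N \<longrightarrow> \<nu> l \<le> \<nu> k) \<and> 0 < \<nu> N \<and>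
     S = lin_span r (pod_mode N \<phi> \<nu> v))"


section \<open>The thermo-poroelasticity model\<close>

record ('d::finite) thermo_poro =
  mu :: real
  lam :: real
  biot_alpha :: real           (* Biot-Willis constant alpha *)
  biot_M :: real               (* Biot modulus M *)
  alpha_T :: real
  alpha_m :: real              (* 3 alpha_m is the thermal dilation coefficient *)
  heat_C :: real               (* effective total heat conductivity C_d *)
  theta0 :: real
  stab_L :: real
  perm :: "real^'d \<Rightarrow> real^'d^'d"      (* permeability tensor K *)
  cond :: "real^'d \<Rightarrow> real^'d^'d"      (* bulk thermal conductivity tensor D *)
  dt :: real
  body_force :: "real \<Rightarrow> real^'d \<Rightarrow> real^'d"
  fluid_src :: "real \<Rightarrow> real^'d \<Rightarrow> real"
  heat_src :: "real \<Rightarrow> real^'d \<Rightarrow> real"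

definition storage_c0 :: "('d::finite) thermo_poro \<Rightarrow> real" where
  "storage_c0 P = 1 / biot_M P"

definition K_dr :: "('d::finite) thermo_poro \<Rightarrow> real" where
  "K_dr P = (real CARD('d) * lam P + 2 * mu P) / real CARD('d)"

definition grid_time :: "('d::finite) thermo_poro \<Rightarrow> nat \<Rightarrow> real" where
  "grid_time P n = real n * dt P"

definition elliptic_tensor ::
    "(real^'d::finite) set \<Rightarrow> (real^'d \<Rightarrow> real^'d^'d) \<Rightarrow> real \<Rightarrow> real \<Rightarrow> bool" where
  "elliptic_tensor \<Omega> A a b \<longleftrightarrow>
     A \<in> borel_measurable (lebesgue_on \<Omega>) \<and> 0 < a \<and> 0 < b \<and>
     (\<forall>x\<in>\<Omega>. transpose (A x) = A x \<and>
        (\<forall>\<xi>. a * (\<xi> \<bullet> \<xi>) \<le> \<xi> \<bullet> (A x *v \<xi>) \<and> \<xi> \<bullet> (A x *v \<xi>) \<le> b * (\<xi> \<bullet> \<xi>)))"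

text \<open>
  The sequences \<open>u i\<close>, \<open>p i\<close>, \<open>\<theta> i\<close> are iterates of the fixed-stress scheme for the
  time step from \<open>(un, pn, \<theta>n)\<close> to time \<open>t\<close>. The initialization is index \<open>0\<close>; it is
  only required to lie in the spaces.
\<close>

definition fixed_stress ::
    "(real^'d::finite) set \<Rightarrow> 'd thermo_poro \<Rightarrow>
     (real^'d \<Rightarrow> real^'d) set \<Rightarrow> (real^'d \<Rightarrow> real) set \<Rightarrow> (real^'d \<Rightarrow> real) set \<Rightarrow> real \<Rightarrow>
     (real^'d \<Rightarrow> real^'d) \<Rightarrow> (real^'d \<Rightarrow> real) \<Rightarrow> (real^'d \<Rightarrow> real) \<Rightarrow>
     (nat \<Rightarrow> real^'d \<Rightarrow> real^'d) \<Rightarrow> (nat \<Rightarrow> real^'d \<Rightarrow> real) \<Rightarrow> (nat \<Rightarrow> real^'d \<Rightarrow> real) \<Rightarrow> bool"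
  where
  "fixed_stress \<Omega> P V W Th t un pn \<theta>n u p \<theta> \<longleftrightarrow>
     un \<in> V \<and> pn \<in> W \<and> \<theta>n \<in> Th \<and> u 0 \<in> V \<and> p 0 \<in> W \<and> \<theta> 0 \<in> Th \<and>
     (\<forall>i.
       (p (Suc i) \<in> W \<and> (\<forall>w\<in>W.
          storage_c0 P * l2_inner \<Omega> (\<lambda>x. (p (Suc i) x - pn x) / dt P) w
          + l2_inner \<Omega> (\<lambda>x. perm P x *v wgrad \<Omega> (p (Suc i)) x) (wgrad \<Omega> w)
          + stab_L P * ((biot_alpha P)\<^sup>2 / K_dr P)
              * l2_inner \<Omega> (\<lambda>x. (p (Suc i) x - p i x) / dt P) w
          = l2_inner \<Omega> (fluid_src P t) w
          - biot_alpha P * l2_inner \<Omega> (wdiv \<Omega> (\<lambda>x. (u i x - un x) /\<^sub>R dt P)) w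
          + 3 * alpha_m P * l2_inner \<Omega> (\<lambda>x. (\<theta> i x - \<theta>n x) / dt P) w)) \<and>
       (\<theta> (Suc i) \<in> Th \<and> (\<forall>s\<in>Th.
          heat_C P * l2_inner \<Omega> (\<lambda>x. (\<theta> (Suc i) x - \<theta>n x) / dt P) s
          + l2_inner \<Omega> (\<lambda>x. cond P x *v wgrad \<Omega> (\<theta> (Suc i)) x) (wgrad \<Omega> s)
          + 9 * stab_L P * (alpha_T P)\<^sup>2 * K_dr P * theta0 P
              * l2_inner \<Omega> (\<lambda>x. (\<theta> (Suc i) x - \<theta> i x) / dt P) s
          = l2_inner \<Omega> (heat_src P t) s
          + 3 * alpha_m P * theta0 P * l2_inner \<Omega> (\<lambda>x. (p i x - pn x) / dt P) s
          - 3 * alpha_T P * K_dr P * theta0 P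
              * l2_inner \<Omega> (wdiv \<Omega> (\<lambda>x. (u i x - un x) /\<^sub>R dt P)) s)) \<and>
       (u (Suc i) \<in> V \<and> (\<forall>v\<in>V.
          2 * mu P * l2_inner \<Omega> (strain \<Omega> (u (Suc i))) (strain \<Omega> v)
          + lam P * l2_inner \<Omega> (wdiv \<Omega> (u (Suc i))) (wdiv \<Omega> v)
          = l2_inner \<Omega> (body_force P t) v
          + biot_alpha P * l2_inner \<Omega> (p (Suc i)) (wdiv \<Omega> v)
          + 3 * alpha_T P * K_dr P * l2_inner \<Omega> (\<theta> (Suc i)) (wdiv \<Omega> v))))"

text \<open>
  High-fidelity fixed-stress run over the time steps \<open>0, \<dots>, N\<close>: the state at step
  \<open>n + 1\<close> is the limit of fixed-stress iterates (with any initialization in the spaces) for the time step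
  from the limit at step \<open>n\<close>.
\<close>

definition fs_hf ::
    "(real^'d::finite) set \<Rightarrow> 'd thermo_poro \<Rightarrow>
     (real^'d \<Rightarrow> real^'d) set \<Rightarrow> (real^'d \<Rightarrow> real) set \<Rightarrow> (real^'d \<Rightarrow> real) set \<Rightarrow> nat \<Rightarrow>
     (nat \<Rightarrow> real^'d \<Rightarrow> real^'d) \<Rightarrow> (nat \<Rightarrow> real^'d \<Rightarrow> real) \<Rightarrow> (nat \<Rightarrow> real^'d \<Rightarrow> real) \<Rightarrow> bool"
  where
  "fs_hf \<Omega> P V W Th N uh ph \<theta>h \<longleftrightarrow>
     (\<forall>n\<le>N. uh n \<in> V \<and> ph n \<in> W \<and> \<theta>h n \<in> Th) \<and>
     (\<forall>n<N. \<exists>u p \<theta>.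
        fixed_stress \<Omega> P V W Th (grid_time P (Suc n)) (uh n) (ph n) (\<theta>h n) u p \<theta> \<and>
        (\<lambda>i. h1v_norm \<Omega> (\<lambda>x. u i x - uh (Suc n) x)) \<longlonglongrightarrow> 0 \<and>
        (\<lambda>i. l2_norm \<Omega> (\<lambda>x. p i x - ph (Suc n) x)) \<longlonglongrightarrow> 0 \<and>
        (\<lambda>i. l2_norm \<Omega> (\<lambda>x. \<theta> i x - \<theta>h (Suc n) x)) \<longlonglongrightarrow> 0)"

text \<open>\<open>(u, p, \<theta>)\<close> is a monolithic Galerkin solution at time \<open>t\<close>, one step after \<open>(un, pn, \<theta>n)\<close>.\<close>

definition monolithic_step ::
    "(real^'d::finite) set \<Rightarrow> 'd thermo_poro \<Rightarrow>
     (real^'d \<Rightarrow> real^'d) set \<Rightarrow> (real^'d \<Rightarrow> real) set \<Rightarrow> (real^'d \<Rightarrow> real) set \<Rightarrow> real \<Rightarrow>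
     (real^'d \<Rightarrow> real^'d) \<Rightarrow> (real^'d \<Rightarrow> real) \<Rightarrow> (real^'d \<Rightarrow> real) \<Rightarrow>
     (real^'d \<Rightarrow> real^'d) \<Rightarrow> (real^'d \<Rightarrow> real) \<Rightarrow> (real^'d \<Rightarrow> real) \<Rightarrow> bool"
  where
  "monolithic_step \<Omega> P V W Th t un pn \<theta>n u p \<theta> \<longleftrightarrow>
     un \<in> V \<and> pn \<in> W \<and> \<theta>n \<in> Th \<and> u \<in> V \<and> p \<in> W \<and> \<theta> \<in> Th \<and>
     (\<forall>v\<in>V.
        2 * mu P * l2_inner \<Omega> (strain \<Omega> u) (strain \<Omega> v)
        + lam P * l2_inner \<Omega> (wdiv \<Omega> u) (wdiv \<Omega> v)
        - biot_alpha P * l2_inner \<Omega> p (wdiv \<Omega> v)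
        - 3 * alpha_T P * K_dr P * l2_inner \<Omega> \<theta> (wdiv \<Omega> v)
        = l2_inner \<Omega> (body_force P t) v) \<and>
     (\<forall>w\<in>W.
        storage_c0 P * l2_inner \<Omega> (\<lambda>x. (p x - pn x) / dt P) w
        + biot_alpha P * l2_inner \<Omega> (\<lambda>x. (wdiv \<Omega> u x - wdiv \<Omega> un x) / dt P) w
        - 3 * alpha_m P * l2_inner \<Omega> (\<lambda>x. (\<theta> x - \<theta>n x) / dt P) w
        + l2_inner \<Omega> (\<lambda>x. perm P x *v wgrad \<Omega> p x) (wgrad \<Omega> w)
        = l2_inner \<Omega> (fluid_src P t) w) \<and>
     (\<forall>s\<in>Th.
        heat_C P * l2_inner \<Omega> (\<lambda>x. (\<theta> x - \<theta>n x) / dt P) s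
        + 3 * alpha_T P * K_dr P * theta0 P
            * l2_inner \<Omega> (\<lambda>x. (wdiv \<Omega> u x - wdiv \<Omega> un x) / dt P) s
        - 3 * alpha_m P * theta0 P * l2_inner \<Omega> (\<lambda>x. (p x - pn x) / dt P) s
        + l2_inner \<Omega> (\<lambda>x. cond P x *v wgrad \<Omega> \<theta> x) (wgrad \<Omega> s)
        = l2_inner \<Omega> (heat_src P t) s)"

end

(*
  The errors e_i = (u_i - u, p_i - p, theta_i - theta) solve the fixed-stress equations without
  data. Test the flow and heat equations with the new pressure and temperature errors. The
  mechanics equation turns the coupling through div u into A(e_i, e_{i+1}), where A is the
  positive semidefinite form on pressure-temperature pairs given by the elastic energy of the
  displacement that they induce. Since K_dr |div v|^2 is at most the elastic energy of v, the
  stabilization form S satisfies A <= 2 S as soon as L >= 1, so |(S - A)(x, x)| <= S(x, x), and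
  polarization bounds the mixed term by (S(e_i, e_i) + S(e_{i+1}, e_{i+1})) / 2. Hence the energy
  S/2 + (3 alpha_m / 2) (|p|^2 + |theta|^2), with |p| and |theta| the L^2 norms of the errors,
  decreases by at least (c_0 - 3 alpha_m) |p|^2 + (C_d / theta_0 - 3 alpha_m) |theta|^2, which
  therefore tends to zero. The displacement error follows by Korn's and Poincare's inequalities.
*)

theory Submission
  imports Defs
begin

section \<open>The space of square-integrable functions\<close>

text \<open>The mixed term A(e_i, e_{i+1}) arises because flow and heat use the old displacement:
  testing the new mechanics equation with the old displacement error collects both couplings in one
  symmetric expression. For this the heat equation is first divided by \<open>theta0 P\<close>; then
  both scalar equations carry the same coefficient 3 alpha_m and the load coefficients of the
  mechanics equation. K_dr equals lambda + 2 mu / d, and its second part comes from |div v|^2 <= d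
  |eps(v)|^2, with eps(v) the strain. The factor 2 in A <= 2 S is the price of splitting the load
  alpha p + 3 alpha_T K_dr theta into two squares, and it is exactly the factor that polarization
  tolerates. The outcome is a telescoping energy, not a contraction factor. The analytic obstacle is
  that a weak gradient is a chosen representative, linear only up to null sets. Linearity, the
  exchange of derivatives behind Korn's inequality and Poincare's inequality are all obtained by
  approximating functions of zero trace by test functions and passing to the limit in
  pairings.\<close>

lemma L2_measurable: "f \<in> L2 \<Omega> \<Longrightarrow> f \<in> borel_measurable (lebesgue_on \<Omega>)"
  by (simp add: L2_def)

lemma L2_integrable_inner:
  assumes "f \<in> L2 \<Omega>" "g \<in> L2 \<Omega>"
  shows "integrable (lebesgue_on \<Omega>) (\<lambda>x. f x \<bullet> g x)"
proof (rule Bochner_Integration.integrable_bound)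
  show "integrable (lebesgue_on \<Omega>) (\<lambda>x. (norm (f x))\<^sup>2 + (norm (g x))\<^sup>2)"
    using assms by (auto simp: L2_def)
  show "(\<lambda>x. f x \<bullet> g x) \<in> borel_measurable (lebesgue_on \<Omega>)"
    using assms by (auto dest!: L2_measurable)
  have "\<bar>a \<bullet> b\<bar> \<le> (norm a)\<^sup>2 + (norm b)\<^sup>2" for a b :: 'b
  proof -
    have "\<bar>a \<bullet> b\<bar> \<le> norm a * norm b" by (rule Cauchy_Schwarz_ineq2)
    also have "\<dots> \<le> 2 * norm a * norm b" by simp
    also have "\<dots> \<le> (norm a)\<^sup>2 + (norm b)\<^sup>2" by (rule sum_squares_bound)
    finally show ?thesis .
  qed
  then show "AE x in lebesgue_on \<Omega>. norm (f x \<bullet> g x) \<le> norm ((norm (f x))\<^sup>2 + (norm (g x))\<^sup>2)"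
    by simp
qed

lemma L2_dominated:
  fixes g :: "_ \<Rightarrow> 'b::euclidean_space"
  assumes "f \<in> L2 \<Omega>" "g \<in> borel_measurable (lebesgue_on \<Omega>)"
    and "\<And>x. x \<in> \<Omega> \<Longrightarrow> norm (g x) \<le> C * norm (f x)" and "\<Omega> \<in> sets lebesgue"
  shows "g \<in> L2 \<Omega>"
proof -
  have "integrable (lebesgue_on \<Omega>) (\<lambda>x. (norm (g x))\<^sup>2)"
  proof (rule Bochner_Integration.integrable_bound)
    show "integrable (lebesgue_on \<Omega>) (\<lambda>x. C\<^sup>2 * (norm (f x))\<^sup>2)"
      using assms by (auto simp: L2_def)
    have "(norm (g x))\<^sup>2 \<le> C\<^sup>2 * (norm (f x))\<^sup>2" if "x \<in> \<Omega>" for x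
      using power_mono[OF assms(3)[OF that], of 2] by (simp add: power_mult_distrib)
    then show "AE x in lebesgue_on \<Omega>. norm ((norm (g x))\<^sup>2) \<le> norm (C\<^sup>2 * (norm (f x))\<^sup>2)"
      by (intro AE_I2) simp
  qed (use assms in simp)
  then show ?thesis using assms by (simp add: L2_def)
qed

lemma L2_add:
  assumes "f \<in> L2 \<Omega>" "g \<in> L2 \<Omega>"
  shows "(\<lambda>x. f x + g x) \<in> L2 \<Omega>"
proof -
  have "integrable (lebesgue_on \<Omega>) (\<lambda>x. (norm (f x))\<^sup>2 + (norm (g x))\<^sup>2 + 2 * (f x \<bullet> g x))"
    using assms L2_integrable_inner[OF assms] by (auto simp: L2_def)
  then have "integrable (lebesgue_on \<Omega>) (\<lambda>x. (norm (f x + g x))\<^sup>2)"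
    by (simp add: power2_norm_eq_inner inner_add_left inner_add_right inner_commute algebra_simps)
  then show ?thesis using assms by (auto simp: L2_def)
qed

lemma L2_bounded_linear:
  assumes "bounded_linear T" "f \<in> L2 \<Omega>" and "\<Omega> \<in> sets lebesgue"
  shows "(\<lambda>x. T (f x)) \<in> L2 \<Omega>"
proof -
  obtain C where C: "\<And>x. norm (T x) \<le> norm x * C"
    using bounded_linear.bounded[OF assms(1)] by blast
  have "T \<in> borel_measurable borel"
    using assms(1) by (intro borel_measurable_continuous_onI linear_continuous_on)
  then have "(\<lambda>x. T (f x)) \<in> borel_measurable (lebesgue_on \<Omega>)"
    using L2_measurable[OF assms(2)] by (rule measurable_compose_rev)
  then show ?thesis
    using C by (intro L2_dominated[OF assms(2), of _ C]) (auto simp: mult.commute assms(3))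
qed

lemma L2_scaleR: "f \<in> L2 \<Omega> \<Longrightarrow> (\<lambda>x. c *\<^sub>R f x) \<in> L2 \<Omega>"
  by (auto simp: L2_def power_mult_distrib)

lemma L2_diff: "f \<in> L2 \<Omega> \<Longrightarrow> g \<in> L2 \<Omega> \<Longrightarrow> (\<lambda>x. f x - g x) \<in> L2 \<Omega>"
  using L2_add[of f \<Omega> "\<lambda>x. (-1) *\<^sub>R g x"] L2_scaleR[of g \<Omega> "-1"] by simp

lemma L2_components:
  fixes f :: "_ \<Rightarrow> 'b::euclidean_space^'m::finite"
  assumes "\<And>i. (\<lambda>x. f x $ i) \<in> L2 \<Omega>"
  shows "f \<in> L2 \<Omega>"
proof -
  have "f \<in> borel_measurable (lebesgue_on \<Omega>)"
  proof (subst borel_measurable_euclidean_space, rule ballI)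
    fix b :: "'b^'m" assume "b \<in> Basis"
    have "(\<lambda>x. \<Sum>i\<in>UNIV. f x $ i \<bullet> b $ i) \<in> borel_measurable (lebesgue_on \<Omega>)"
      using assms by (intro borel_measurable_sum borel_measurable_inner) (auto dest: L2_measurable)
    then show "(\<lambda>x. f x \<bullet> b) \<in> borel_measurable (lebesgue_on \<Omega>)"
      by (simp add: inner_vec_def)
  qed
  moreover have "integrable (lebesgue_on \<Omega>) (\<lambda>x. \<Sum>i\<in>UNIV. (norm (f x $ i))\<^sup>2)"
    using assms by (auto simp: L2_def)
  then have "integrable (lebesgue_on \<Omega>) (\<lambda>x. (norm (f x))\<^sup>2)"
    by (simp add: power2_norm_eq_inner inner_vec_def)
  ultimately show ?thesis by (simp add: L2_def)
qed

section \<open>Bilinearity of the inner product, Cauchy-Schwarz, limits and comparison\<close>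

lemma l2_inner_commute: "l2_inner \<Omega> f g = l2_inner \<Omega> g f"
  by (simp add: l2_inner_def inner_commute)

lemma l2_inner_add_left:
  assumes "f \<in> L2 \<Omega>" "g \<in> L2 \<Omega>" "h \<in> L2 \<Omega>"
  shows "l2_inner \<Omega> (\<lambda>x. f x + g x) h = l2_inner \<Omega> f h + l2_inner \<Omega> g h"
  using assms by (simp add: l2_inner_def inner_add_left L2_integrable_inner)

lemma l2_inner_diff_left:
  assumes "f \<in> L2 \<Omega>" "g \<in> L2 \<Omega>" "h \<in> L2 \<Omega>"
  shows "l2_inner \<Omega> (\<lambda>x. f x - g x) h = l2_inner \<Omega> f h - l2_inner \<Omega> g h"
  using assms by (simp add: l2_inner_def inner_diff_left L2_integrable_inner)

lemma l2_inner_scaleR_left: "l2_inner \<Omega> (\<lambda>x. c *\<^sub>R f x) h = c * l2_inner \<Omega> f h"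
  by (simp add: l2_inner_def)

lemma l2_inner_add_right:
  assumes "f \<in> L2 \<Omega>" "g \<in> L2 \<Omega>" "h \<in> L2 \<Omega>"
  shows "l2_inner \<Omega> h (\<lambda>x. f x + g x) = l2_inner \<Omega> h f + l2_inner \<Omega> h g"
  using l2_inner_add_left[OF assms] by (simp add: l2_inner_commute[of \<Omega> h])

lemma l2_inner_diff_right:
  assumes "f \<in> L2 \<Omega>" "g \<in> L2 \<Omega>" "h \<in> L2 \<Omega>"
  shows "l2_inner \<Omega> h (\<lambda>x. f x - g x) = l2_inner \<Omega> h f - l2_inner \<Omega> h g"
  using l2_inner_diff_left[OF assms] by (simp add: l2_inner_commute[of \<Omega> h])

lemma l2_inner_scaleR_right: "l2_inner \<Omega> h (\<lambda>x. c *\<^sub>R f x) = c * l2_inner \<Omega> h f"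
  by (simp add: l2_inner_def)

lemma l2_inner_nonneg: "0 \<le> l2_inner \<Omega> f f"
  by (simp add: l2_inner_def)

lemma l2_norm_nonneg [simp]: "0 \<le> l2_norm \<Omega> f"
  by (simp add: l2_norm_def l2_inner_nonneg)

lemma l2_norm_power2: "(l2_norm \<Omega> f)\<^sup>2 = l2_inner \<Omega> f f"
  by (simp add: l2_norm_def l2_inner_nonneg)

lemma l2_inner_cong_AE:
  assumes "f \<in> L2 \<Omega>" "f' \<in> L2 \<Omega>" "g \<in> L2 \<Omega>" "g' \<in> L2 \<Omega>"
    and "AE x in lebesgue_on \<Omega>. f x = f' x" "AE x in lebesgue_on \<Omega>. g x = g' x"
  shows "l2_inner \<Omega> f g = l2_inner \<Omega> f' g'"
  unfolding l2_inner_def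
proof (rule integral_cong_AE)
  show "AE x in lebesgue_on \<Omega>. f x \<bullet> g x = f' x \<bullet> g' x" using assms(5,6) by eventually_elim simp
qed (use assms in \<open>auto dest!: L2_measurable\<close>)

lemma l2_inner_diff_self:
  assumes "f \<in> L2 \<Omega>" "g \<in> L2 \<Omega>"
  shows "l2_inner \<Omega> (\<lambda>x. f x - g x) (\<lambda>x. f x - g x)
    = l2_inner \<Omega> f f - 2 * l2_inner \<Omega> f g + l2_inner \<Omega> g g"
  using assms
  by (simp add: l2_inner_diff_left l2_inner_diff_right L2_diff l2_inner_commute[of \<Omega> g f])

text \<open>The quadratic polynomial |f - t g|^2 in t is nonnegative, which bounds its discriminant.
  Functions are not identified up to null sets, so a degenerate leading coefficient is a case of its
  own.\<close>

lemma l2_cauchy_schwarz: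
  assumes "f \<in> L2 \<Omega>" "g \<in> L2 \<Omega>"
  shows "\<bar>l2_inner \<Omega> f g\<bar> \<le> l2_norm \<Omega> f * l2_norm \<Omega> g"
proof -
  define a b c where "a = l2_inner \<Omega> f f" and "b = l2_inner \<Omega> f g" and "c = l2_inner \<Omega> g g"
  have quad: "0 \<le> a - 2 * t * b + t\<^sup>2 * c" for t
    using l2_inner_nonneg[of \<Omega> "\<lambda>x. f x - t *\<^sub>R g x"]
      l2_inner_diff_self[OF assms(1) L2_scaleR[OF assms(2)], of t]
    by (simp add: a_def b_def c_def l2_inner_scaleR_left l2_inner_scaleR_right power2_eq_square mult.assoc)
  have ac: "0 \<le> a" "0 \<le> c" by (simp_all add: a_def c_def l2_inner_nonneg)
  have "b\<^sup>2 \<le> a * c"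
  proof (cases "c = 0")
    case True
    have "b = 0"
    proof (rule ccontr)
      assume "b \<noteq> 0"
      \<comment> \<open>For c = 0 the polynomial is affine in t, and this t gives it the value
        -1.\<close>
      then show False using quad[of "(a + 1) / (2 * b)"] True ac by (simp add: field_simps)
    qed
    then show ?thesis using True by simp
  next
    case False
    \<comment> \<open>The minimizer t = b / c is inserted.\<close>
    have "b * b + b * b \<le> a * c + b * b"
      using quad[of "b / c"] False ac by (simp add: field_simps power2_eq_square)
    then show ?thesis by (simp add: power2_eq_square)
  qed
  then have "\<bar>b\<bar> \<le> sqrt (a * c)" by (simp add: real_le_rsqrt)
  then show ?thesis by (simp add: a_def b_def c_def l2_norm_def real_sqrt_mult)
qed

lemma l2_inner_tendsto_left:
  assumes "(\<lambda>k. l2_norm \<Omega> (\<lambda>x. f k x - f' x)) \<longlonglongrightarrow> 0"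
    and "\<And>k. f k \<in> L2 \<Omega>" "f' \<in> L2 \<Omega>" "g \<in> L2 \<Omega>"
  shows "(\<lambda>k. l2_inner \<Omega> (f k) g) \<longlonglongrightarrow> l2_inner \<Omega> f' g"
proof -
  have "(\<lambda>k. l2_inner \<Omega> (f k) g - l2_inner \<Omega> f' g) \<longlonglongrightarrow> 0"
  proof (rule Lim_null_comparison)
    show "\<forall>\<^sub>F k in sequentially. norm (l2_inner \<Omega> (f k) g - l2_inner \<Omega> f' g)
        \<le> l2_norm \<Omega> (\<lambda>x. f k x - f' x) * l2_norm \<Omega> g"
      using l2_cauchy_schwarz[OF L2_diff[OF assms(2,3)] assms(4)] assms
      by (simp add: l2_inner_diff_left)
    show "(\<lambda>k. l2_norm \<Omega> (\<lambda>x. f k x - f' x) * l2_norm \<Omega> g) \<longlonglongrightarrow> 0"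
      using tendsto_mult_right[OF assms(1)] by simp
  qed
  then show ?thesis using LIM_zero_iff by blast
qed

lemma l2_inner_tendsto_right:
  assumes "(\<lambda>k. l2_norm \<Omega> (\<lambda>x. f k x - f' x)) \<longlonglongrightarrow> 0"
    and "\<And>k. f k \<in> L2 \<Omega>" "f' \<in> L2 \<Omega>" "g \<in> L2 \<Omega>"
  shows "(\<lambda>k. l2_inner \<Omega> g (f k)) \<longlonglongrightarrow> l2_inner \<Omega> g f'"
  using l2_inner_tendsto_left[OF assms] by (simp add: l2_inner_commute[of \<Omega> g])

lemma l2_norm_mono:
  fixes f :: "_ \<Rightarrow> 'b::euclidean_space" and g :: "_ \<Rightarrow> 'c::euclidean_space"
  assumes "f \<in> L2 \<Omega>" "g \<in> L2 \<Omega>" "\<And>x. x \<in> \<Omega> \<Longrightarrow> norm (f x) \<le> norm (g x)"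
  shows "l2_norm \<Omega> f \<le> l2_norm \<Omega> g"
proof -
  have "l2_inner \<Omega> f f \<le> l2_inner \<Omega> g g"
    unfolding l2_inner_def
    using assms by (intro integral_mono L2_integrable_inner) (auto simp: norm_le)
  then show ?thesis by (simp add: l2_norm_def)
qed

lemma l2_inner_self_eq_0:
  assumes "f \<in> L2 \<Omega>" "l2_inner \<Omega> f f = 0"
  shows "AE x in lebesgue_on \<Omega>. f x = 0"
proof -
  have "AE x in lebesgue_on \<Omega>. f x \<bullet> f x = 0"
    using assms L2_integrable_inner[OF assms(1,1)]
    by (subst integral_nonneg_eq_0_iff_AE[symmetric]) (auto simp: l2_inner_def)
  then show ?thesis by simp
qed

lemma l2_inner_vec:
  fixes f g :: "_ \<Rightarrow> 'b::euclidean_space^'m::finite"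
  assumes "\<And>i. (\<lambda>x. f x $ i) \<in> L2 \<Omega>" "\<And>i. (\<lambda>x. g x $ i) \<in> L2 \<Omega>"
  shows "l2_inner \<Omega> f g = (\<Sum>i\<in>UNIV. l2_inner \<Omega> (\<lambda>x. f x $ i) (\<lambda>x. g x $ i))"
  using L2_integrable_inner[OF assms] by (simp add: l2_inner_def inner_vec_def)

section \<open>Test functions\<close>

text \<open>Reduces partial derivatives to derivatives in one real variable, to which the mean value
  theorem applies.\<close>

lemma has_real_derivative_grad:
  fixes f :: "real^'d::finite \<Rightarrow> real"
  assumes "f differentiable at (y + s *\<^sub>R axis i 1)"
  shows "((\<lambda>s. f (y + s *\<^sub>R axis i 1)) has_real_derivative grad f (y + s *\<^sub>R axis i 1) $ i) (at s)"
proof -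
  let ?D = "frechet_derivative f (at (y + s *\<^sub>R axis i 1))"
  have "((\<lambda>s. y + s *\<^sub>R axis i 1) has_derivative (\<lambda>h. h *\<^sub>R axis i 1)) (at s)"
    by (auto intro!: derivative_eq_intros)
  from has_derivative_compose[OF this frechet_derivative_works[THEN iffD1, OF assms]]
  have "((\<lambda>s. f (y + s *\<^sub>R axis i 1)) has_derivative (\<lambda>h. ?D (h *\<^sub>R axis i 1))) (at s)" .
  moreover have "linear ?D" using assms linear_frechet_derivative by blast
  ultimately show ?thesis
    by (simp add: has_field_derivative_def grad_def linear_scale mult_commute_abs)
qed

lemma k_times_cont_diff_continuous: "k_times_cont_diff k f \<Longrightarrow> continuous_on UNIV f"
  by (cases k) (auto intro!: differentiable_imp_continuous_on differentiable_at_imp_differentiable_on)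

lemma k_times_cont_diff_Suc_imp: "k_times_cont_diff (Suc k) f \<Longrightarrow> k_times_cont_diff k f"
proof (induction k arbitrary: f)
  case 0
  then show ?case using k_times_cont_diff_continuous k_times_cont_diff.simps(1) by blast
qed auto

text \<open>Two applications of the mean value theorem: in direction i to the increment of f in
  direction j, then in direction j to the i-th partial derivative. The left side is symmetric in i
  and j, whereas the right side fixes an order of differentiation.\<close>

lemma second_difference_quotient:
  fixes f :: "real^'d::finite \<Rightarrow> real"
  assumes "k_times_cont_diff 2 f" "0 < h"
  shows "\<exists>y. dist y x \<le> 2 * h \<and>
    f (x + h *\<^sub>R axis i 1 + h *\<^sub>R axis j 1) - f (x + h *\<^sub>R axis i 1) - f (x + h *\<^sub>R axis j 1) + f x
      = h\<^sup>2 * grad (\<lambda>z. grad f z $ i) y $ j"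
proof -
  let ?a = "axis i 1 :: real^'d" and ?b = "axis j 1 :: real^'d"
  have df: "f differentiable at z" and dg: "(\<lambda>z. grad f z $ i) differentiable at z" for z
    using assms(1) by (auto simp: numeral_2_eq_2)
  have D1: "((\<lambda>s. f (x + h *\<^sub>R ?b + s *\<^sub>R ?a) - f (x + s *\<^sub>R ?a)) has_real_derivative
      grad f (x + h *\<^sub>R ?b + s *\<^sub>R ?a) $ i - grad f (x + s *\<^sub>R ?a) $ i) (at s)" for s
    by (intro DERIV_diff has_real_derivative_grad df)
  then obtain s where s: "0 < s" "s < h"
    "(f (x + h *\<^sub>R ?b + h *\<^sub>R ?a) - f (x + h *\<^sub>R ?a)) - (f (x + h *\<^sub>R ?b + 0 *\<^sub>R ?a) - f (x + 0 *\<^sub>R ?a))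
      = (h - 0) * (grad f (x + h *\<^sub>R ?b + s *\<^sub>R ?a) $ i - grad f (x + s *\<^sub>R ?a) $ i)"
    using MVT2[OF assms(2) D1] by blast
  have D2: "((\<lambda>t. grad f (x + s *\<^sub>R ?a + t *\<^sub>R ?b) $ i) has_real_derivative
      grad (\<lambda>z. grad f z $ i) (x + s *\<^sub>R ?a + t *\<^sub>R ?b) $ j) (at t)" for t
    by (intro has_real_derivative_grad dg)
  then obtain t where t: "0 < t" "t < h"
    "grad f (x + s *\<^sub>R ?a + h *\<^sub>R ?b) $ i - grad f (x + s *\<^sub>R ?a + 0 *\<^sub>R ?b) $ i
      = (h - 0) * grad (\<lambda>z. grad f z $ i) (x + s *\<^sub>R ?a + t *\<^sub>R ?b) $ j"
    using MVT2[OF assms(2) D2] by blast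
  have "norm (s *\<^sub>R ?a + t *\<^sub>R ?b) \<le> s + t"
    using norm_triangle_ineq[of "s *\<^sub>R ?a" "t *\<^sub>R ?b"] s t by (simp add: norm_axis_1)
  then have "dist (x + s *\<^sub>R ?a + t *\<^sub>R ?b) x \<le> 2 * h"
    using s t by (simp add: dist_norm add.assoc)
  then show ?thesis
    using s(3) t(3) by (intro exI[of _ "x + s *\<^sub>R ?a + t *\<^sub>R ?b"])
      (simp add: algebra_simps power2_eq_square)
qed

text \<open>Schwarz's theorem. Both orders of differentiation give the same second difference, at
  points y and z near x; continuity of both mixed derivatives then excludes a gap between their
  values at x.\<close>

lemma grad_grad_commute:
  fixes f :: "real^'d::finite \<Rightarrow> real"
  assumes "k_times_cont_diff 2 f"
  shows "grad (\<lambda>z. grad f z $ i) x $ j = grad (\<lambda>z. grad f z $ j) x $ i"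
proof (rule ccontr)
  define F where "F = (\<lambda>x. grad (\<lambda>z. grad f z $ i) x $ j)"
  define G where "G = (\<lambda>x. grad (\<lambda>z. grad f z $ j) x $ i)"
  assume "grad (\<lambda>z. grad f z $ i) x $ j \<noteq> grad (\<lambda>z. grad f z $ j) x $ i"
  then have e: "0 < \<bar>F x - G x\<bar> / 2" by (simp add: F_def G_def)
  have "continuous_on UNIV F" "continuous_on UNIV G"
    using assms by (auto simp: F_def G_def numeral_2_eq_2)
  then have "isCont F x" "isCont G x" by (auto simp: continuous_on_eq_continuous_at)
  then obtain d1 d2 where d: "d1 > 0" "d2 > 0"
    "\<And>y. dist y x < d1 \<Longrightarrow> dist (F y) (F x) < \<bar>F x - G x\<bar> / 2"
    "\<And>y. dist y x < d2 \<Longrightarrow> dist (G y) (G x) < \<bar>F x - G x\<bar> / 2"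
    using e unfolding continuous_at_eps_delta by metis
  \<comment> \<open>The intermediate points lie within 2 h of x, so a third of the radius keeps them
    strictly inside.\<close>
  define h where "h = min d1 d2 / 3"
  have h: "0 < h" "2 * h < d1" "2 * h < d2" using d by (auto simp: h_def)
  obtain y where y: "dist y x \<le> 2 * h" "f (x + h *\<^sub>R axis i 1 + h *\<^sub>R axis j 1) - f (x + h *\<^sub>R axis i 1)
      - f (x + h *\<^sub>R axis j 1) + f x = h\<^sup>2 * F y"
    using second_difference_quotient[OF assms h(1)] unfolding F_def by blast
  obtain z where z: "dist z x \<le> 2 * h" "f (x + h *\<^sub>R axis j 1 + h *\<^sub>R axis i 1) - f (x + h *\<^sub>R axis j 1)
      - f (x + h *\<^sub>R axis i 1) + f x = h\<^sup>2 * G z"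
    using second_difference_quotient[OF assms h(1)] unfolding G_def by blast
  have "h\<^sup>2 * F y = h\<^sup>2 * G z" using y(2) z(2) by (simp add: algebra_simps)
  then have "F y = G z" using h by simp
  moreover have "dist (F y) (F x) < \<bar>F x - G x\<bar> / 2" "dist (G z) (G x) < \<bar>F x - G x\<bar> / 2"
    using d y(1) z(1) h by auto
  ultimately show False by (simp add: dist_real_def abs_if split: if_splits)
qed

text \<open>Outside the compact S the function vanishes on an open set, so the same S serves for the
  derivative. Hence the identity defining weak gradients can be tested with derivatives of test
  functions.\<close>

lemma test_functions_grad:
  assumes "\<phi> \<in> test_functions \<Omega>"
  shows "(\<lambda>x. grad \<phi> x $ i) \<in> test_functions \<Omega>"
proof -
  have k: "k_times_cont_diff k \<phi>" for k using assms by (simp add: test_functions_def)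
  obtain S where S: "compact S" "S \<subseteq> \<Omega>" "\<And>x. x \<notin> S \<Longrightarrow> \<phi> x = 0"
    using assms by (auto simp: test_functions_def)
  have "grad \<phi> x = 0" if "x \<notin> S" for x
  proof -
    have "open (- S)" using S(1) compact_imp_closed by blast
    have "(\<phi> has_derivative (\<lambda>_. 0)) (at x)"
      by (rule has_derivative_transform_within_open[OF has_derivative_const[of 0] \<open>open (- S)\<close>])
        (use that S in auto)
    then show ?thesis by (simp add: frechet_derivative_at[symmetric] grad_def vec_eq_iff)
  qed
  moreover have "k_times_cont_diff k (\<lambda>x. grad \<phi> x $ i)" for k
    using k[of "Suc k"] by simp
  ultimately show ?thesis using S by (auto simp: test_functions_def)
qed

section \<open>Products of test functions with coordinates\<close>

lemma k_times_cont_diff_add: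
  "k_times_cont_diff k f \<Longrightarrow> k_times_cont_diff k g \<Longrightarrow> k_times_cont_diff k (\<lambda>x. f x + g x)"
proof (induction k arbitrary: f g)
  case (Suc k)
  have "((\<lambda>x. f x + g x) has_derivative (\<lambda>h. frechet_derivative f (at x) h + frechet_derivative g (at x) h)) (at x)" for x
    using Suc.prems by (auto intro!: has_derivative_add simp: frechet_derivative_works)
  from frechet_derivative_at[OF this]
  have "grad (\<lambda>x. f x + g x) x $ i = grad f x $ i + grad g x $ i" for x i
    by (simp add: grad_def fun_eq_iff)
  then show ?case using Suc by simp
qed (auto intro: continuous_intros)

lemma k_times_cont_diff_scale:
  "k_times_cont_diff k f \<Longrightarrow> k_times_cont_diff k (\<lambda>x. c * f x)"
proof (induction k arbitrary: f)
  case (Suc k)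
  have "((\<lambda>x. c * f x) has_derivative (\<lambda>h. c * frechet_derivative f (at x) h)) (at x)" for x
    using Suc.prems by (auto intro!: has_derivative_mult_right simp: frechet_derivative_works)
  from frechet_derivative_at[OF this]
  have "grad (\<lambda>x. c * f x) x $ i = c * grad f x $ i" for x i
    by (simp add: grad_def fun_eq_iff)
  then show ?case using Suc by simp
qed (auto intro: continuous_intros)

lemma has_derivative_coord_mult:
  fixes f :: "real^'d::finite \<Rightarrow> real"
  assumes "f differentiable at x"
  shows "((\<lambda>x. x $ j * f x) has_derivative (\<lambda>h. x $ j * frechet_derivative f (at x) h + h $ j * f x)) (at x)"
  using assms by (auto intro!: has_derivative_mult bounded_linear.has_derivative[OF bounded_linear_vec_nth]
      has_derivative_ident simp: frechet_derivative_works)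

lemma grad_coord_mult:
  fixes f :: "real^'d::finite \<Rightarrow> real"
  assumes "f differentiable at x"
  shows "grad (\<lambda>x. x $ j * f x) x $ i = x $ j * grad f x $ i + (if i = j then 1 else 0) * f x"
  using fun_cong[OF frechet_derivative_at[OF has_derivative_coord_mult[OF assms, of j]], of "axis i 1"]
  by (cases "i = j") (simp_all add: grad_def axis_def)

lemma k_times_cont_diff_coord_mult:
  "k_times_cont_diff k f \<Longrightarrow> k_times_cont_diff k (\<lambda>x. x $ j * f x)"
proof (induction k arbitrary: f)
  case (Suc k)
  have "f differentiable at x" for x using Suc.prems by simp
  then have "(\<lambda>x. x $ j * f x) differentiable at x" for x
    using has_derivative_coord_mult differentiable_def by blast
  \<comment> \<open>By the product rule this is the derivative. Its second term contains f itself,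
    which has to be lowered from order k + 1 to order k.\<close>
  moreover have "k_times_cont_diff k (\<lambda>x. x $ j * grad f x $ i + (if i = j then 1 else 0) * f x)" for i
    using Suc.prems by (intro k_times_cont_diff_add k_times_cont_diff_scale Suc.IH)
      (auto intro: k_times_cont_diff_Suc_imp)
  ultimately show ?case using Suc.prems by (simp add: grad_coord_mult)
qed (auto intro!: continuous_intros)

text \<open>Coordinates are the multipliers in the proof of Poincare's inequality.\<close>

lemma test_functions_coord_mult:
  assumes "\<phi> \<in> test_functions \<Omega>"
  shows "(\<lambda>x. x $ j * \<phi> x) \<in> test_functions \<Omega>"
proof -
  have "\<exists>S. compact S \<and> S \<subseteq> \<Omega> \<and> (\<forall>x. x \<notin> S \<longrightarrow> x $ j * \<phi> x = 0)"
    using assms by (auto simp: test_functions_def)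
  then show ?thesis
    using assms k_times_cont_diff_coord_mult by (auto simp: test_functions_def)
qed

lemma test_functions_L2:
  assumes "\<phi> \<in> test_functions \<Omega>" "open \<Omega>" "bounded \<Omega>"
  shows "\<phi> \<in> L2 \<Omega>"
proof -
  obtain S where S: "compact S" "S \<subseteq> \<Omega>" "\<And>x. x \<notin> S \<Longrightarrow> \<phi> x = 0"
    using assms by (auto simp: test_functions_def)
  have cont: "continuous_on UNIV \<phi>"
    using assms k_times_cont_diff_continuous by (auto simp: test_functions_def)
  have "bounded (\<phi> ` S)"
    using cont S(1) by (meson compact_continuous_image compact_imp_bounded continuous_on_subset subset_UNIV)
  then obtain B where B: "\<And>x. x \<in> S \<Longrightarrow> norm (\<phi> x) \<le> B" unfolding bounded_iff by auto
  have 1: "(\<lambda>x. 1::real) \<in> L2 \<Omega>"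
    using assms lmeasurable_open[of \<Omega>]
    by (auto simp: L2_def integrable_restrict_space fmeasurable_def)
  \<comment> \<open>The maximum with 0 covers points outside S, where B says nothing and may even be
    negative.\<close>
  have "norm (\<phi> x) \<le> max 0 B * norm (1::real)" for x
    using B[of x] S(3)[of x] by (cases "x \<in> S") auto
  moreover have "\<phi> \<in> borel_measurable (lebesgue_on \<Omega>)"
    using cont assms(2) by (intro continuous_imp_measurable_on_sets_lebesgue) (auto intro: continuous_on_subset)
  ultimately show ?thesis
    using assms(2) by (intro L2_dominated[OF 1]) auto
qed

section \<open>Weak gradients of functions with zero trace\<close>

context
  fixes \<Omega> :: "(real^'d::finite) set"
  assumes open_dom: "open \<Omega>" and bounded_dom: "bounded \<Omega>"
begin

lemma lebesgue_dom: "\<Omega> \<in> sets lebesgue"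
  using open_dom by auto

lemma H10_L2: "u \<in> H10 \<Omega> \<Longrightarrow> u \<in> L2 \<Omega>"
  by (simp add: H10_def H1_def)

lemma H10_is_weak_grad:
  assumes "u \<in> H10 \<Omega>"
  shows "is_weak_grad \<Omega> u (wgrad \<Omega> u)"
proof -
  have "\<exists>g. is_weak_grad \<Omega> u g" using assms by (simp add: H10_def H1_def)
  then show ?thesis unfolding wgrad_def by (rule someI_ex)
qed

lemma L2_vec_nth: "f \<in> L2 \<Omega> \<Longrightarrow> (\<lambda>x. f x $ i) \<in> L2 \<Omega>"
  using L2_bounded_linear[OF bounded_linear_vec_nth] lebesgue_dom by blast

lemma wgrad_L2: "u \<in> H10 \<Omega> \<Longrightarrow> wgrad \<Omega> u \<in> L2 \<Omega>"
  using H10_is_weak_grad by (auto simp: is_weak_grad_def)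

lemma wgrad_nth_L2: "u \<in> H10 \<Omega> \<Longrightarrow> (\<lambda>x. wgrad \<Omega> u x $ i) \<in> L2 \<Omega>"
  by (intro L2_vec_nth wgrad_L2)

lemma wgrad_parts:
  "u \<in> H10 \<Omega> \<Longrightarrow> \<phi> \<in> test_functions \<Omega> \<Longrightarrow>
    l2_inner \<Omega> u (\<lambda>x. grad \<phi> x $ i) = - l2_inner \<Omega> (\<lambda>x. wgrad \<Omega> u x $ i) \<phi>"
  using H10_is_weak_grad by (auto simp: is_weak_grad_def)

lemma test_L2: "\<phi> \<in> test_functions \<Omega> \<Longrightarrow> \<phi> \<in> L2 \<Omega>"
  using test_functions_L2 open_dom bounded_dom by blast

text \<open>The definition of zero trace recast as convergence of pairings with a fixed
  square-integrable function, by Cauchy-Schwarz. All later limits are taken in this form.\<close>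

lemma H10_approx:
  assumes "u \<in> H10 \<Omega>"
  shows "\<exists>\<psi>. (\<forall>k. \<psi> k \<in> test_functions \<Omega>) \<and>
    (\<forall>f\<in>L2 \<Omega>. (\<lambda>k. l2_inner \<Omega> f (\<psi> k)) \<longlonglongrightarrow> l2_inner \<Omega> f u) \<and>
    (\<forall>f\<in>L2 \<Omega>. \<forall>i. (\<lambda>k. l2_inner \<Omega> f (\<lambda>x. grad (\<psi> k) x $ i)) \<longlonglongrightarrow> l2_inner \<Omega> f (\<lambda>x. wgrad \<Omega> u x $ i))"
proof -
  obtain \<psi> where \<psi>: "\<And>k. \<psi> k \<in> test_functions \<Omega>"
    "(\<lambda>k. l2_norm \<Omega> (\<lambda>x. \<psi> k x - u x)) \<longlonglongrightarrow> 0"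
    "(\<lambda>k. l2_norm \<Omega> (\<lambda>x. grad (\<psi> k) x - wgrad \<Omega> u x)) \<longlonglongrightarrow> 0"
    using assms by (auto simp: H10_def)
  have G: "grad (\<psi> k) \<in> L2 \<Omega>" for k
    by (rule L2_components) (rule test_L2[OF test_functions_grad[OF \<psi>(1)]])
  note L = L2_diff[OF G wgrad_L2[OF assms]]
  have lim: "(\<lambda>k. l2_norm \<Omega> (\<lambda>x. grad (\<psi> k) x $ i - wgrad \<Omega> u x $ i)) \<longlonglongrightarrow> 0" for i
  proof (rule Lim_null_comparison[OF always_eventually \<psi>(3)], rule allI)
    fix k
    have "l2_norm \<Omega> (\<lambda>x. (grad (\<psi> k) x - wgrad \<Omega> u x) $ i)
        \<le> l2_norm \<Omega> (\<lambda>x. grad (\<psi> k) x - wgrad \<Omega> u x)"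
      by (rule l2_norm_mono[OF L2_vec_nth[OF L] L]) (rule Finite_Cartesian_Product.norm_nth_le)
    then show "norm (l2_norm \<Omega> (\<lambda>x. grad (\<psi> k) x $ i - wgrad \<Omega> u x $ i))
        \<le> l2_norm \<Omega> (\<lambda>x. grad (\<psi> k) x - wgrad \<Omega> u x)"
      by simp
  qed
  show ?thesis
    by (intro exI[of _ \<psi>] conjI ballI allI \<psi>(1)
        l2_inner_tendsto_right[OF \<psi>(2) test_L2[OF \<psi>(1)] H10_L2[OF assms]]
        l2_inner_tendsto_right[OF lim L2_vec_nth[OF G] wgrad_nth_L2[OF assms]])
qed

text \<open>The weak derivative is a limit of derivatives of test functions, and these are test
  functions themselves.\<close>

lemma orthogonal_to_wgrad:
  assumes "h \<in> L2 \<Omega>" "\<And>\<phi>. \<phi> \<in> test_functions \<Omega> \<Longrightarrow> l2_inner \<Omega> h \<phi> = 0" "u \<in> H10 \<Omega>"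
  shows "l2_inner \<Omega> h (\<lambda>x. wgrad \<Omega> u x $ i) = 0"
proof -
  obtain \<psi> where \<psi>: "\<And>k. \<psi> k \<in> test_functions \<Omega>"
    "\<And>f i. f \<in> L2 \<Omega> \<Longrightarrow>
      (\<lambda>k. l2_inner \<Omega> f (\<lambda>x. grad (\<psi> k) x $ i)) \<longlonglongrightarrow> l2_inner \<Omega> f (\<lambda>x. wgrad \<Omega> u x $ i)"
    using H10_approx[OF assms(3)] by blast
  from \<psi>(2)[OF assms(1)] show ?thesis
    unfolding assms(2)[OF test_functions_grad[OF \<psi>(1)]] by (simp add: LIMSEQ_const_iff)
qed

text \<open>
  The defect of linearity is orthogonal to all test functions, and it is itself a limit of test
  functions; so the density of the test functions in \<open>L\<^sup>2\<close> is not needed.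
\<close>

lemma wgrad_lincomb:
  assumes "u \<in> H10 \<Omega>" "v \<in> H10 \<Omega>" "(\<lambda>x. a * u x + b * v x) \<in> H10 \<Omega>"
  shows "AE x in lebesgue_on \<Omega>.
    wgrad \<Omega> (\<lambda>x. a * u x + b * v x) x = a *\<^sub>R wgrad \<Omega> u x + b *\<^sub>R wgrad \<Omega> v x"
proof -
  define w where "w = (\<lambda>x. a * u x + b * v x)"
  have w: "w \<in> H10 \<Omega>" using assms by (simp add: w_def)
  define g where "g = (\<lambda>i x. a *\<^sub>R wgrad \<Omega> u x $ i + b *\<^sub>R wgrad \<Omega> v x $ i)"
  define h where "h = (\<lambda>i x. wgrad \<Omega> w x $ i - g i x)"
  have g: "g i \<in> L2 \<Omega>" for i
    unfolding g_def by (intro L2_add L2_scaleR wgrad_nth_L2 assms)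
  have h: "h i \<in> L2 \<Omega>" for i
    unfolding h_def by (intro L2_diff g wgrad_nth_L2 w)
  have orth: "l2_inner \<Omega> (h i) \<phi> = 0" if \<phi>: "\<phi> \<in> test_functions \<Omega>" for i \<phi>
  proof -
    note D = wgrad_nth_L2[OF assms(1), of i] wgrad_nth_L2[OF assms(2), of i]
    note \<phi>_L2 = test_L2[OF \<phi>] and grad_L2 = test_L2[OF test_functions_grad[OF \<phi>, of i]]
    have "l2_inner \<Omega> (h i) \<phi> = l2_inner \<Omega> (\<lambda>x. wgrad \<Omega> w x $ i) \<phi> - l2_inner \<Omega> (g i) \<phi>"
      unfolding h_def by (rule l2_inner_diff_left[OF wgrad_nth_L2[OF w] g \<phi>_L2])
    also have "l2_inner \<Omega> (g i) \<phi>
        = a * l2_inner \<Omega> (\<lambda>x. wgrad \<Omega> u x $ i) \<phi> + b * l2_inner \<Omega> (\<lambda>x. wgrad \<Omega> v x $ i) \<phi>"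
      using l2_inner_add_left[OF L2_scaleR[OF D(1)] L2_scaleR[OF D(2)] \<phi>_L2, of a b]
      unfolding g_def by (simp only: l2_inner_scaleR_left)
    also have "l2_inner \<Omega> (\<lambda>x. wgrad \<Omega> w x $ i) \<phi> - \<dots> = - l2_inner \<Omega> w (\<lambda>x. grad \<phi> x $ i)
        + (a * l2_inner \<Omega> u (\<lambda>x. grad \<phi> x $ i) + b * l2_inner \<Omega> v (\<lambda>x. grad \<phi> x $ i))"
      by (simp add: wgrad_parts[OF w \<phi>] wgrad_parts[OF assms(1) \<phi>] wgrad_parts[OF assms(2) \<phi>])
    also have "\<dots> = 0"
      using l2_inner_add_left[OF L2_scaleR[OF H10_L2[OF assms(1)]] L2_scaleR[OF H10_L2[OF assms(2)]] grad_L2, of a b]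
      unfolding w_def by (simp only: l2_inner_scaleR_left) (simp add: l2_inner_scaleR_left[where ?'b=real, simplified])
    finally show ?thesis .
  qed
  have "l2_inner \<Omega> (h i) (h i) = 0" for i
  proof -
    have "l2_inner \<Omega> (h i) (h i) = l2_inner \<Omega> (h i) (\<lambda>x. wgrad \<Omega> w x $ i) - l2_inner \<Omega> (h i) (g i)"
      unfolding h_def by (rule l2_inner_diff_right[OF wgrad_nth_L2[OF w] g h[unfolded h_def]])
    also have "l2_inner \<Omega> (h i) (g i) = a * l2_inner \<Omega> (h i) (\<lambda>x. wgrad \<Omega> u x $ i)
        + b * l2_inner \<Omega> (h i) (\<lambda>x. wgrad \<Omega> v x $ i)"
      unfolding g_def
      using l2_inner_add_right[OF L2_scaleR[OF wgrad_nth_L2[OF assms(1)]] L2_scaleR[OF wgrad_nth_L2[OF assms(2)]] h]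
      by (simp only: l2_inner_scaleR_right)
    finally show ?thesis
      using orthogonal_to_wgrad[OF h orth] assms w by simp
  qed
  then have "AE x in lebesgue_on \<Omega>. h i x = 0" for i
    using l2_inner_self_eq_0 h by blast
  then have "AE x in lebesgue_on \<Omega>. \<forall>i\<in>UNIV. h i x = 0"
    by (intro AE_finite_allI) auto
  then show ?thesis
    by eventually_elim (simp add: h_def g_def w_def vec_eq_iff)
qed

text \<open>For a test function in place of v, moving one derivative off u shows that both sides
  equal minus the pairing of u with the mixed second derivative, where the order is immaterial. Only
  v is approximated, so u needs no second derivatives.\<close>

lemma wgrad_swap:
  assumes "u \<in> H10 \<Omega>" "v \<in> H10 \<Omega>"
  shows "l2_inner \<Omega> (\<lambda>x. wgrad \<Omega> u x $ i) (\<lambda>x. wgrad \<Omega> v x $ j)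
    = l2_inner \<Omega> (\<lambda>x. wgrad \<Omega> u x $ j) (\<lambda>x. wgrad \<Omega> v x $ i)"
proof -
  obtain \<psi> where \<psi>: "\<And>k. \<psi> k \<in> test_functions \<Omega>"
    "\<And>f i. f \<in> L2 \<Omega> \<Longrightarrow>
      (\<lambda>k. l2_inner \<Omega> f (\<lambda>x. grad (\<psi> k) x $ i)) \<longlonglongrightarrow> l2_inner \<Omega> f (\<lambda>x. wgrad \<Omega> v x $ i)"
    using H10_approx[OF assms(2)] by blast
  have lim: "(\<lambda>k. l2_inner \<Omega> (\<lambda>x. wgrad \<Omega> u x $ i) (\<lambda>x. grad (\<psi> k) x $ j))
      \<longlonglongrightarrow> l2_inner \<Omega> (\<lambda>x. wgrad \<Omega> u x $ i) (\<lambda>x. wgrad \<Omega> v x $ j)" for i j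
    by (rule \<psi>(2)[OF wgrad_nth_L2[OF assms(1)]])
  have "k_times_cont_diff 2 (\<psi> k)" for k using \<psi>(1) by (auto simp: test_functions_def)
  then have swap: "l2_inner \<Omega> (\<lambda>x. wgrad \<Omega> u x $ i) (\<lambda>x. grad (\<psi> k) x $ j)
      = l2_inner \<Omega> (\<lambda>x. wgrad \<Omega> u x $ j) (\<lambda>x. grad (\<psi> k) x $ i)" for k
    using wgrad_parts[OF assms(1) test_functions_grad[OF \<psi>(1)[of k], of j], of i]
      wgrad_parts[OF assms(1) test_functions_grad[OF \<psi>(1)[of k], of i], of j]
    by (simp add: grad_grad_commute[of _ i _ j])
  from lim[of i j] show ?thesis unfolding swap by (rule LIMSEQ_unique[OF _ lim[of j i]])
qed

text \<open>Integrate \<open>u\<^sup>2 = u\<^sup>2 \<partial>\<^sub>i x\<^sub>i\<close> by parts.\<close>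

lemma poincare_component:
  assumes "u \<in> H10 \<Omega>" "\<And>x. x \<in> \<Omega> \<Longrightarrow> \<bar>x $ i\<bar> \<le> R"
  shows "l2_norm \<Omega> u \<le> 2 * R * l2_norm \<Omega> (\<lambda>x. wgrad \<Omega> u x $ i)"
proof -
  obtain \<psi> where \<psi>: "\<And>k. \<psi> k \<in> test_functions \<Omega>"
    "\<And>f. f \<in> L2 \<Omega> \<Longrightarrow> (\<lambda>k. l2_inner \<Omega> f (\<psi> k)) \<longlonglongrightarrow> l2_inner \<Omega> f u"
    "\<And>f i. f \<in> L2 \<Omega> \<Longrightarrow>
      (\<lambda>k. l2_inner \<Omega> f (\<lambda>x. grad (\<psi> k) x $ i)) \<longlonglongrightarrow> l2_inner \<Omega> f (\<lambda>x. wgrad \<Omega> u x $ i)"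
    using H10_approx[OF assms(1)] by blast
  let ?D = "\<lambda>x. wgrad \<Omega> u x $ i"
  have coord: "(\<lambda>x. x $ i * f x) \<in> L2 \<Omega>" if f: "f \<in> L2 \<Omega>" for f
  proof (rule L2_dominated[OF f])
    show "norm (x $ i * f x) \<le> R * norm (f x)" if "x \<in> \<Omega>" for x
      using assms(2)[OF that] by (simp add: abs_mult mult_right_mono)
    have "(\<lambda>x. x $ i) \<in> borel_measurable (lebesgue_on \<Omega>)"
      using open_dom by (intro continuous_imp_measurable_on_sets_lebesgue continuous_intros) auto
    then show "(\<lambda>x. x $ i * f x) \<in> borel_measurable (lebesgue_on \<Omega>)"
      using L2_measurable[OF f] by simp
  qed (rule lebesgue_dom)
  have u: "u \<in> L2 \<Omega>" and D: "?D \<in> L2 \<Omega>" using assms by (auto intro: H10_L2 wgrad_nth_L2)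
  \<comment> \<open>The weak derivative of u is tested with x_i times the approximant; the product
    rule produces the pairing of u with the approximant, whose limit is the square of the
    norm.\<close>
  have parts: "l2_inner \<Omega> (\<lambda>x. x $ i * u x) (\<lambda>x. grad (\<psi> k) x $ i) + l2_inner \<Omega> u (\<psi> k)
      = - l2_inner \<Omega> (\<lambda>x. x $ i * ?D x) (\<psi> k)" for k
  proof -
    have d: "\<psi> k differentiable at x" for x
      using \<psi>(1)[of k] by (auto simp: test_functions_def dest: spec[of _ "Suc 0"])
    have "l2_inner \<Omega> u (\<lambda>x. x $ i * grad (\<psi> k) x $ i + \<psi> k x) = - l2_inner \<Omega> ?D (\<lambda>x. x $ i * \<psi> k x)"
      using wgrad_parts[OF assms(1) test_functions_coord_mult[OF \<psi>(1)[of k], of i], of i]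
      by (simp add: grad_coord_mult d)
    moreover have "l2_inner \<Omega> u (\<lambda>x. x $ i * grad (\<psi> k) x $ i + \<psi> k x)
        = l2_inner \<Omega> u (\<lambda>x. x $ i * grad (\<psi> k) x $ i) + l2_inner \<Omega> u (\<psi> k)"
      by (rule l2_inner_add_right[OF coord[OF test_L2[OF test_functions_grad[OF \<psi>(1)]]] test_L2[OF \<psi>(1)] u])
    ultimately show ?thesis by (simp add: l2_inner_def mult_ac)
  qed
  have "(\<lambda>k. l2_inner \<Omega> (\<lambda>x. x $ i * u x) (\<lambda>x. grad (\<psi> k) x $ i) + l2_inner \<Omega> u (\<psi> k))
      \<longlonglongrightarrow> l2_inner \<Omega> (\<lambda>x. x $ i * u x) ?D + l2_inner \<Omega> u u"
    by (rule tendsto_add[OF \<psi>(3)[OF coord[OF u]] \<psi>(2)[OF u]])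
  moreover have "(\<lambda>k. - l2_inner \<Omega> (\<lambda>x. x $ i * ?D x) (\<psi> k)) \<longlonglongrightarrow> - l2_inner \<Omega> (\<lambda>x. x $ i * ?D x) u"
    by (rule tendsto_minus[OF \<psi>(2)[OF coord[OF D]]])
  ultimately have "l2_inner \<Omega> (\<lambda>x. x $ i * u x) ?D + l2_inner \<Omega> u u = - l2_inner \<Omega> (\<lambda>x. x $ i * ?D x) u"
    unfolding parts by (rule LIMSEQ_unique)
  then have "(l2_norm \<Omega> u)\<^sup>2 = - 2 * l2_inner \<Omega> u (\<lambda>x. x $ i * ?D x)"
    by (simp add: l2_norm_power2 l2_inner_def mult_ac)
  also have "\<dots> \<le> 2 * (l2_norm \<Omega> u * l2_norm \<Omega> (\<lambda>x. x $ i * ?D x))"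
    using l2_cauchy_schwarz[OF u coord[OF D]] by linarith
  finally have 1: "(l2_norm \<Omega> u)\<^sup>2 \<le> l2_norm \<Omega> u * (2 * l2_norm \<Omega> (\<lambda>x. x $ i * ?D x))" by simp
  have "l2_norm \<Omega> (\<lambda>x. x $ i * ?D x) \<le> l2_norm \<Omega> (\<lambda>x. R *\<^sub>R ?D x)"
  proof (rule l2_norm_mono[OF coord[OF D] L2_scaleR[OF D]])
    fix x assume "x \<in> \<Omega>"
    then have "\<bar>x $ i\<bar> \<le> \<bar>R\<bar>" using assms(2)[of x] by linarith
    then show "norm (x $ i * ?D x) \<le> norm (R *\<^sub>R ?D x)" by (simp add: abs_mult mult_right_mono)
  qed
  also have "\<dots> = \<bar>R\<bar> * l2_norm \<Omega> ?D"
    unfolding l2_norm_def l2_inner_scaleR_left l2_inner_scaleR_right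
    by (simp add: real_sqrt_mult mult.assoc[symmetric])
  finally have "2 * l2_norm \<Omega> (\<lambda>x. x $ i * ?D x) \<le> 2 * \<bar>R\<bar> * l2_norm \<Omega> ?D" by simp
  from order_trans[OF 1 mult_left_mono[OF this l2_norm_nonneg]]
  have *: "(l2_norm \<Omega> u)\<^sup>2 \<le> l2_norm \<Omega> u * (2 * \<bar>R\<bar> * l2_norm \<Omega> ?D)" .
  show ?thesis
  \<comment> \<open>A point of the domain is what forces R >= 0; over the empty set both norms
    vanish.\<close>
  proof (cases "\<Omega> = {}")
    case True
    then show ?thesis by (simp add: l2_norm_def l2_inner_def integral_eq_zero_null_sets)
  next
    case False
    then obtain x where "x \<in> \<Omega>" by blast
    then have R: "R \<ge> 0" using assms(2)[of x] by linarith
    show ?thesis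
    proof (cases "l2_norm \<Omega> u = 0")
      case True
      then show ?thesis using R by simp
    next
      case False
      then have "0 < l2_norm \<Omega> u" by (simp add: less_le)
      then show ?thesis using * R unfolding power2_eq_square by (simp only: mult_le_cancel_left_pos abs_of_nonneg)
    qed
  qed
qed

section \<open>Weak Jacobian, divergence and strain of vector fields; Korn's inequality\<close>

lemma H10v_component: "u \<in> H10v \<Omega> \<Longrightarrow> (\<lambda>x. u x $ i) \<in> H10 \<Omega>"
  by (simp add: H10v_def)

lemma wjac_row_L2: "u \<in> H10v \<Omega> \<Longrightarrow> (\<lambda>x. wjac \<Omega> u x $ i) \<in> L2 \<Omega>"
  by (simp add: wjac_def wgrad_L2 H10v_component)

lemma wjac_L2: "u \<in> H10v \<Omega> \<Longrightarrow> wjac \<Omega> u \<in> L2 \<Omega>"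
  by (intro L2_components wjac_row_L2)

lemma bounded_linear_transpose: "bounded_linear (transpose :: real^'d^'d \<Rightarrow> real^'d^'d)"
  by (subst linear_conv_bounded_linear[symmetric])
    (auto intro!: linearI simp: transpose_def vec_eq_iff)

lemma bounded_linear_trace: "bounded_linear (trace :: real^'d^'d \<Rightarrow> real)"
  by (subst linear_conv_bounded_linear[symmetric])
    (auto intro!: linearI simp: trace_def sum.distrib sum_distrib_left)

lemma wjac_transpose_L2: "u \<in> H10v \<Omega> \<Longrightarrow> (\<lambda>x. transpose (wjac \<Omega> u x)) \<in> L2 \<Omega>"
  by (intro L2_bounded_linear[OF bounded_linear_transpose] wjac_L2 lebesgue_dom)

lemma wdiv_L2: "u \<in> H10v \<Omega> \<Longrightarrow> wdiv \<Omega> u \<in> L2 \<Omega>"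
  using L2_bounded_linear[OF bounded_linear_trace wjac_L2 lebesgue_dom] by (simp add: wdiv_def[abs_def])

lemma strain_L2: "u \<in> H10v \<Omega> \<Longrightarrow> strain \<Omega> u \<in> L2 \<Omega>"
  unfolding strain_def[abs_def] by (intro L2_scaleR L2_add wjac_L2 wjac_transpose_L2)

lemma wjac_lincomb:
  assumes "u \<in> H10v \<Omega>" "v \<in> H10v \<Omega>" "(\<lambda>x. a *\<^sub>R u x + b *\<^sub>R v x) \<in> H10v \<Omega>"
  shows "AE x in lebesgue_on \<Omega>.
    wjac \<Omega> (\<lambda>x. a *\<^sub>R u x + b *\<^sub>R v x) x = a *\<^sub>R wjac \<Omega> u x + b *\<^sub>R wjac \<Omega> v x"
proof -
  have "AE x in lebesgue_on \<Omega>. wgrad \<Omega> (\<lambda>x. a * u x $ i + b * v x $ i) x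
      = a *\<^sub>R wgrad \<Omega> (\<lambda>x. u x $ i) x + b *\<^sub>R wgrad \<Omega> (\<lambda>x. v x $ i) x" for i
    using H10v_component[OF assms(3), of i] by (intro wgrad_lincomb H10v_component assms) simp
  then have "AE x in lebesgue_on \<Omega>. \<forall>i\<in>UNIV. wgrad \<Omega> (\<lambda>x. a * u x $ i + b * v x $ i) x
      = a *\<^sub>R wgrad \<Omega> (\<lambda>x. u x $ i) x + b *\<^sub>R wgrad \<Omega> (\<lambda>x. v x $ i) x"
    by (intro AE_finite_allI) auto
  then show ?thesis
    by eventually_elim (simp add: wjac_def vec_eq_iff)
qed

lemma wdiv_lincomb:
  assumes "u \<in> H10v \<Omega>" "v \<in> H10v \<Omega>" "(\<lambda>x. a *\<^sub>R u x + b *\<^sub>R v x) \<in> H10v \<Omega>"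
  shows "AE x in lebesgue_on \<Omega>.
    wdiv \<Omega> (\<lambda>x. a *\<^sub>R u x + b *\<^sub>R v x) x = a *\<^sub>R wdiv \<Omega> u x + b *\<^sub>R wdiv \<Omega> v x"
  using wjac_lincomb[OF assms]
  by eventually_elim (simp add: wdiv_def trace_def sum.distrib sum_distrib_left)

lemma strain_lincomb:
  assumes "u \<in> H10v \<Omega>" "v \<in> H10v \<Omega>" "(\<lambda>x. a *\<^sub>R u x + b *\<^sub>R v x) \<in> H10v \<Omega>"
  shows "AE x in lebesgue_on \<Omega>.
    strain \<Omega> (\<lambda>x. a *\<^sub>R u x + b *\<^sub>R v x) x = a *\<^sub>R strain \<Omega> u x + b *\<^sub>R strain \<Omega> v x"
  using wjac_lincomb[OF assms]
  by eventually_elim (simp add: strain_def transpose_def vec_eq_iff algebra_simps)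

text \<open>Pointwise, 2 |strain|^2 = |J|^2 + J : J^T for the Jacobian J. Because of the zero trace,
  derivatives may be exchanged under the integral, which turns the second term into the square of
  the divergence.\<close>

lemma strain_power2:
  assumes "u \<in> H10v \<Omega>"
  shows "2 * l2_inner \<Omega> (strain \<Omega> u) (strain \<Omega> u)
    = l2_inner \<Omega> (wjac \<Omega> u) (wjac \<Omega> u) + l2_inner \<Omega> (wdiv \<Omega> u) (wdiv \<Omega> u)"
proof -
  let ?J = "wjac \<Omega> u"
  let ?D = "\<lambda>i j x. wgrad \<Omega> (\<lambda>x. u x $ i) x $ j"
  have L2[simp]: "?D i j \<in> L2 \<Omega>" for i j
    by (intro wgrad_nth_L2 H10v_component assms)
  have tt: "transpose A \<bullet> transpose A = A \<bullet> A" for A :: "real^'d^'d"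
    unfolding inner_vec_def transpose_def by (simp, rule sum.swap)
  have "2 * (S \<bullet> S) = A \<bullet> A + A \<bullet> transpose A" if "S = (1/2) *\<^sub>R (A + transpose A)" for S A :: "real^'d^'d"
    using tt[of A] unfolding that
    by (simp add: inner_add_left inner_add_right inner_commute[of "transpose A" A] field_simps)
  then have "2 * l2_inner \<Omega> (strain \<Omega> u) (strain \<Omega> u) = (LINT x|lebesgue_on \<Omega>. ?J x \<bullet> ?J x + ?J x \<bullet> transpose (?J x))"
    unfolding l2_inner_def by (simp only: Bochner_Integration.integral_mult_right_zero[symmetric] strain_def)
  also have "\<dots> = l2_inner \<Omega> ?J ?J + l2_inner \<Omega> ?J (\<lambda>x. transpose (?J x))"
    unfolding l2_inner_def
    by (intro Bochner_Integration.integral_add L2_integrable_inner wjac_L2 wjac_transpose_L2 assms)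
  also have "l2_inner \<Omega> ?J (\<lambda>x. transpose (?J x)) = (\<Sum>i\<in>UNIV. \<Sum>j\<in>UNIV. l2_inner \<Omega> (?D i j) (?D j i))"
    using L2_integrable_inner[OF L2 L2]
    by (simp add: l2_inner_def inner_vec_def wjac_def transpose_def)
  \<comment> \<open>\<open>wgrad_swap\<close> for components i and j exchanges the directions j and
    i: d_j u_i times d_i u_j becomes d_i u_i times d_j u_j.\<close>
  also have "\<dots> = (\<Sum>i\<in>UNIV. \<Sum>j\<in>UNIV. l2_inner \<Omega> (?D i i) (?D j j))"
    by (intro sum.cong refl wgrad_swap H10v_component assms)
  also have "\<dots> = l2_inner \<Omega> (wdiv \<Omega> u) (wdiv \<Omega> u)"
    using L2_integrable_inner[OF L2 L2]
    by (simp add: l2_inner_def wdiv_def wjac_def trace_def sum_product)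
  finally show ?thesis .
qed

text \<open>The divergence term of the identity above is nonnegative; this yields the explicit
  constant 2 without a compactness argument.\<close>

lemma korn:
  assumes "u \<in> H10v \<Omega>"
  shows "l2_inner \<Omega> (wjac \<Omega> u) (wjac \<Omega> u) \<le> 2 * l2_inner \<Omega> (strain \<Omega> u) (strain \<Omega> u)"
  using strain_power2[OF assms] l2_inner_nonneg[of \<Omega> "wdiv \<Omega> u"] by simp

text \<open>The divergence is the trace of the strain, that is, its Frobenius product with the
  identity matrix, whose squared norm is d.\<close>

lemma wdiv_le_strain:
  assumes "u \<in> H10v \<Omega>"
  shows "l2_inner \<Omega> (wdiv \<Omega> u) (wdiv \<Omega> u)
    \<le> real CARD('d) * l2_inner \<Omega> (strain \<Omega> u) (strain \<Omega> u)"
proof -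
  have tr: "trace A * trace A \<le> real CARD('d) * (A \<bullet> A)" for A :: "real^'d^'d"
  proof -
    have "(trace A)\<^sup>2 \<le> (\<Sum>i\<in>UNIV. (A $ i $ i)\<^sup>2) * (\<Sum>i::'d\<in>UNIV. 1)"
      using Cauchy_Schwarz_ineq_sum[of "\<lambda>i. A $ i $ i" "\<lambda>_. 1" UNIV] by (simp add: trace_def)
    also have "(\<Sum>i\<in>UNIV. (A $ i $ i)\<^sup>2) \<le> A \<bullet> A"
      unfolding inner_vec_def
      by (intro sum_mono) (auto simp: power2_eq_square intro: member_le_sum[of _ _ "\<lambda>j. A $ i $ j * A $ i $ j" for i])
    finally show ?thesis by (simp add: power2_eq_square mult.commute mult_right_mono)
  qed
  have "trace (strain \<Omega> u x) = wdiv \<Omega> u x" for x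
    by (simp add: strain_def wdiv_def trace_def transpose_def sum.distrib flip: sum_divide_distrib)
  then have "wdiv \<Omega> u x \<bullet> wdiv \<Omega> u x \<le> real CARD('d) * (strain \<Omega> u x \<bullet> strain \<Omega> u x)" for x
    using tr[of "strain \<Omega> u x"] by simp
  then have "(LINT x|lebesgue_on \<Omega>. wdiv \<Omega> u x \<bullet> wdiv \<Omega> u x)
      \<le> (LINT x|lebesgue_on \<Omega>. real CARD('d) * (strain \<Omega> u x \<bullet> strain \<Omega> u x))"
    by (intro integral_mono integrable_mult_right L2_integrable_inner wdiv_L2 strain_L2 assms)
  then show ?thesis by (simp add: l2_inner_def)
qed

text \<open>The constant is 2 (4 R^2 + 1) for a domain inside the ball of radius R: 4 R^2 is the
  square of the Poincare constant 2 R, 1 accounts for the Jacobian itself, and 2 is Korn's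
  constant.\<close>

lemma h1v_le_strain:
  obtains C where "0 \<le> C"
    "\<And>u. u \<in> H10v \<Omega> \<Longrightarrow> h1v_inner \<Omega> u u \<le> C * l2_inner \<Omega> (strain \<Omega> u) (strain \<Omega> u)"
proof -
  obtain R where R: "\<And>x. x \<in> \<Omega> \<Longrightarrow> norm x \<le> R" "0 < R"
    using bounded_dom bounded_pos by metis
  have "h1v_inner \<Omega> u u \<le> 2 * (4 * R\<^sup>2 + 1) * l2_inner \<Omega> (strain \<Omega> u) (strain \<Omega> u)" if u: "u \<in> H10v \<Omega>" for u
  proof -
    note H = H10v_component[OF u]
    have "l2_inner \<Omega> (\<lambda>x. u x $ i) (\<lambda>x. u x $ i)
        \<le> 4 * R\<^sup>2 * l2_inner \<Omega> (\<lambda>x. wjac \<Omega> u x $ i) (\<lambda>x. wjac \<Omega> u x $ i)" for i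
    proof -
      let ?g = "wgrad \<Omega> (\<lambda>x. u x $ i)"
      have "\<bar>x $ i\<bar> \<le> R" if "x \<in> \<Omega>" for x
        using R(1)[OF that] component_le_norm_cart[of x i] by linarith
      then have "l2_norm \<Omega> (\<lambda>x. u x $ i) \<le> 2 * R * l2_norm \<Omega> (\<lambda>x. ?g x $ i)"
        by (rule poincare_component[OF H])
      also have "l2_norm \<Omega> (\<lambda>x. ?g x $ i) \<le> l2_norm \<Omega> ?g"
        by (intro l2_norm_mono wgrad_nth_L2 wgrad_L2 H) (simp add: component_le_norm_cart)
      finally have "l2_norm \<Omega> (\<lambda>x. u x $ i) \<le> 2 * R * l2_norm \<Omega> ?g" using R(2) by simp
      from power_mono[OF this, of 2] show ?thesis
        by (simp add: power_mult_distrib l2_norm_power2 wjac_def)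
    qed
    then have "l2_inner \<Omega> u u \<le> 4 * R\<^sup>2 * l2_inner \<Omega> (wjac \<Omega> u) (wjac \<Omega> u)"
      by (simp add: l2_inner_vec[of u] l2_inner_vec[of "wjac \<Omega> u"] wjac_row_L2[OF u] H10_L2[OF H]
          sum_distrib_left sum_mono)
    then have "h1v_inner \<Omega> u u \<le> (4 * R\<^sup>2 + 1) * l2_inner \<Omega> (wjac \<Omega> u) (wjac \<Omega> u)"
      by (simp add: h1v_inner_def algebra_simps)
    also have "\<dots> \<le> (4 * R\<^sup>2 + 1) * (2 * l2_inner \<Omega> (strain \<Omega> u) (strain \<Omega> u))"
      by (intro mult_left_mono korn u) simp
    finally show ?thesis by (simp only: mult_ac)
  qed
  then show ?thesis by (intro that[of "2 * (4 * R\<^sup>2 + 1)"]) auto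
qed

text \<open>Ellipticity bounds only the quadratic form q of A, while square integrability needs a
  bound on |A v|. Symmetry supplies it: with \<eta> = A \<xi>, polarization gives 4 t |\<eta>|^2 =
  q(\<xi> + t \<eta>) - q(\<xi> - t \<eta>), and the subtracted term is nonnegative.\<close>

lemma elliptic_tensor_L2:
  assumes "elliptic_tensor \<Omega> A a b" "v \<in> L2 \<Omega>"
  shows "(\<lambda>x. A x *v v x) \<in> L2 \<Omega>"
proof (rule L2_dominated[OF assms(2)])
  have "continuous_on UNIV (\<lambda>x::(real^'d^'d) \<times> (real^'d). fst x *v snd x)"
    unfolding matrix_vector_mult_def
    by (intro continuous_on_vec_lambda continuous_intros)
  then show "(\<lambda>x. A x *v v x) \<in> borel_measurable (lebesgue_on \<Omega>)"
    using assms by (intro borel_measurable_continuous_Pair[where H="(*v)"]) (simp_all add: elliptic_tensor_def L2_measurable)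
  show "norm (A x *v v x) \<le> b * norm (v x)" if x: "x \<in> \<Omega>" for x
  proof -
    define \<xi> \<eta> where "\<xi> = v x" and "\<eta> = A x *v v x"
    have sym: "transpose (A x) = A x" and a: "0 < a" and b: "0 < b"
      and lo': "a * (\<zeta> \<bullet> \<zeta>) \<le> \<zeta> \<bullet> (A x *v \<zeta>)" and hi: "\<zeta> \<bullet> (A x *v \<zeta>) \<le> b * (\<zeta> \<bullet> \<zeta>)" for \<zeta>
      using assms(1) x by (simp_all add: elliptic_tensor_def)
    have lo: "0 \<le> \<zeta> \<bullet> (A x *v \<zeta>)" for \<zeta>
      using lo'[of \<zeta>] mult_nonneg_nonneg[OF less_imp_le[OF a] inner_ge_zero[of \<zeta>]] by linarith
    have cross: "4 * t * (\<eta> \<bullet> \<eta>) \<le> b * (norm \<xi> + t * norm \<eta>)\<^sup>2" if "0 \<le> t" for t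
    proof -
      have "\<xi> \<bullet> (A x *v \<eta>) = \<eta> \<bullet> \<eta>"
        using dot_lmul_matrix[of \<xi> "A x" \<eta>] transpose_matrix_vector[of "A x" \<xi>] sym
        by (simp add: \<eta>_def \<xi>_def)
      moreover have "\<eta> \<bullet> (A x *v \<xi>) = \<eta> \<bullet> \<eta>" by (simp add: \<eta>_def \<xi>_def)
      ultimately have "4 * t * (\<eta> \<bullet> \<eta>) = (\<xi> + t *\<^sub>R \<eta>) \<bullet> (A x *v (\<xi> + t *\<^sub>R \<eta>))
          - (\<xi> - t *\<^sub>R \<eta>) \<bullet> (A x *v (\<xi> - t *\<^sub>R \<eta>))"
        by (simp add: algebra_simps inner_add_left inner_add_right inner_diff_left inner_diff_right
            matrix_vector_mult_scaleR)
      also have "\<dots> \<le> b * (norm (\<xi> + t *\<^sub>R \<eta>))\<^sup>2"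
        using hi[of "\<xi> + t *\<^sub>R \<eta>"] lo[of "\<xi> - t *\<^sub>R \<eta>"] by (simp add: power2_norm_eq_inner)
      also have "\<dots> \<le> b * (norm \<xi> + t * norm \<eta>)\<^sup>2"
        using b norm_triangle_ineq[of \<xi> "t *\<^sub>R \<eta>"] that by (intro mult_left_mono power_mono) auto
      finally show ?thesis .
    qed
    have "norm \<eta> \<le> b * norm \<xi>"
    proof (cases "\<eta> = 0 \<or> \<xi> = 0")
      case True
      then show ?thesis using b by (auto simp: \<eta>_def \<xi>_def)
    next
      case False
      then have n: "norm \<xi> > 0" "norm \<eta> > 0" by auto
      \<comment> \<open>This t makes both summands on the right equal to |\<xi>|, so the inequality
        reads 4 |\<xi>| |\<eta>| <= 4 b |\<xi>|^2.\<close>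
      have "4 * (norm \<xi> / norm \<eta>) * (norm \<eta> * norm \<eta>) \<le> b * (norm \<xi> + (norm \<xi> / norm \<eta>) * norm \<eta>)\<^sup>2"
        using cross[of "norm \<xi> / norm \<eta>"] by (simp add: dot_square_norm power2_eq_square)
      then have "(4 * norm \<xi>) * norm \<eta> \<le> (4 * norm \<xi>) * (b * norm \<xi>)"
        using n by (simp add: power2_eq_square algebra_simps)
      then show ?thesis using n by (simp only: mult_le_cancel_left_pos)
    qed
    then show ?thesis by (simp add: \<eta>_def \<xi>_def)
  qed
qed (rule lebesgue_dom)

lemma elliptic_tensor_nonneg:
  assumes "elliptic_tensor \<Omega> A a b"
  shows "0 \<le> l2_inner \<Omega> (\<lambda>x. A x *v v x) v"
  unfolding l2_inner_def
proof (rule integral_nonneg_AE, rule AE_I2)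
  fix x assume "x \<in> space (lebesgue_on \<Omega>)"
  then have "a * (v x \<bullet> v x) \<le> v x \<bullet> (A x *v v x)" "0 < a"
    using assms by (auto simp: elliptic_tensor_def)
  moreover have "0 \<le> a * (v x \<bullet> v x)" using \<open>0 < a\<close> by simp
  ultimately show "0 \<le> (A x *v v x) \<bullet> v x" unfolding inner_commute[of "A x *v v x"] by linarith
qed

end

section \<open>The elasticity form\<close>

definition elast :: "(real^'d::finite) set \<Rightarrow> 'd thermo_poro \<Rightarrow> (real^'d \<Rightarrow> real^'d) \<Rightarrow> (real^'d \<Rightarrow> real^'d) \<Rightarrow> real" where
  "elast \<Omega> P u v = 2 * mu P * l2_inner \<Omega> (strain \<Omega> u) (strain \<Omega> v)
     + lam P * l2_inner \<Omega> (wdiv \<Omega> u) (wdiv \<Omega> v)"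

lemma elast_commute: "elast \<Omega> P u v = elast \<Omega> P v u"
  by (simp add: elast_def l2_inner_commute)

lemma l2_inner_lincomb_left:
  assumes "f \<in> L2 \<Omega>" "g \<in> L2 \<Omega>" "h \<in> L2 \<Omega>"
  shows "l2_inner \<Omega> (\<lambda>x. a *\<^sub>R f x + b *\<^sub>R g x) h = a * l2_inner \<Omega> f h + b * l2_inner \<Omega> g h"
  by (simp only: l2_inner_add_left[OF L2_scaleR[OF assms(1)] L2_scaleR[OF assms(2)] assms(3)] l2_inner_scaleR_left)

text \<open>Linearity in the form that suits weak derivatives: the combination is given only almost
  everywhere, and \<open>k\<close> is a representative of its own.\<close>

lemma l2_inner_AE_lincomb:
  assumes "f \<in> L2 \<Omega>" "g \<in> L2 \<Omega>" "h \<in> L2 \<Omega>" "k \<in> L2 \<Omega>"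
    and "AE x in lebesgue_on \<Omega>. k x = a *\<^sub>R f x + b *\<^sub>R g x"
  shows "l2_inner \<Omega> k h = a * l2_inner \<Omega> f h + b * l2_inner \<Omega> g h"
  using l2_inner_cong_AE[OF assms(4) L2_add[OF L2_scaleR[OF assms(1)] L2_scaleR[OF assms(2)]] assms(3,3,5)]
    l2_inner_lincomb_left[OF assms(1-3)]
  by simp

lemma l2_inner_div_diff_left:
  fixes f g h :: "real^'d::finite \<Rightarrow> real"
  assumes "f \<in> L2 \<Omega>" "g \<in> L2 \<Omega>" "h \<in> L2 \<Omega>"
  shows "l2_inner \<Omega> (\<lambda>x. (f x - g x) / t) h = (l2_inner \<Omega> f h - l2_inner \<Omega> g h) / t"
  using l2_inner_scaleR_left[of \<Omega> "1 / t" "\<lambda>x. f x - g x" h] l2_inner_diff_left[OF assms]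
  by simp

context
  fixes \<Omega> :: "(real^'d::finite) set"
  assumes open_dom: "open \<Omega>" and bounded_dom: "bounded \<Omega>"
begin

lemma wdiv_inner_lincomb:
  assumes "u \<in> H10v \<Omega>" "v \<in> H10v \<Omega>" "w \<in> H10v \<Omega>" "w = (\<lambda>x. a *\<^sub>R u x + b *\<^sub>R v x)" "f \<in> L2 \<Omega>"
  shows "l2_inner \<Omega> (wdiv \<Omega> w) f = a * l2_inner \<Omega> (wdiv \<Omega> u) f + b * l2_inner \<Omega> (wdiv \<Omega> v) f"
  using assms wdiv_lincomb[OF open_dom bounded_dom, of u v a b]
  by (intro l2_inner_AE_lincomb wdiv_L2[OF open_dom bounded_dom]) auto

lemma elast_lincomb:
  assumes "u \<in> H10v \<Omega>" "v \<in> H10v \<Omega>" "w \<in> H10v \<Omega>" "w = (\<lambda>x. a *\<^sub>R u x + b *\<^sub>R v x)" "z \<in> H10v \<Omega>"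
  shows "elast \<Omega> P w z = a * elast \<Omega> P u z + b * elast \<Omega> P v z"
proof -
  have "l2_inner \<Omega> (strain \<Omega> w) (strain \<Omega> z)
      = a * l2_inner \<Omega> (strain \<Omega> u) (strain \<Omega> z) + b * l2_inner \<Omega> (strain \<Omega> v) (strain \<Omega> z)"
    using assms strain_lincomb[OF open_dom bounded_dom, of u v a b]
    by (intro l2_inner_AE_lincomb strain_L2[OF open_dom bounded_dom]) auto
  moreover note wdiv_inner_lincomb[OF assms(1-4) wdiv_L2[OF open_dom bounded_dom assms(5)]]
  ultimately show ?thesis by (simp add: elast_def algebra_simps)
qed

lemma K_dr_pos: "0 < mu P \<Longrightarrow> 0 \<le> lam P \<Longrightarrow> 0 < K_dr (P :: 'd thermo_poro)"
  unfolding K_dr_def by (intro divide_pos_pos add_nonneg_pos) simp_all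

lemma elast_ge_strain:
  "0 \<le> lam P \<Longrightarrow> 2 * mu P * l2_inner \<Omega> (strain \<Omega> u) (strain \<Omega> u) \<le> elast \<Omega> P u u"
  by (simp add: elast_def l2_inner_nonneg)

lemma elast_nonneg: "0 \<le> mu P \<Longrightarrow> 0 \<le> lam P \<Longrightarrow> 0 \<le> elast \<Omega> P u u"
  by (simp add: elast_def l2_inner_nonneg)

text \<open>K_dr is lambda + 2 mu / d: the first part is the divergence energy itself, the second
  comes from the trace bound on the strain energy.\<close>

lemma elast_ge_wdiv:
  assumes "u \<in> H10v \<Omega>" "0 \<le> mu P"
  shows "K_dr P * l2_inner \<Omega> (wdiv \<Omega> u) (wdiv \<Omega> u) \<le> elast \<Omega> P u u"
proof -
  have "2 * mu P / real CARD('d) * l2_inner \<Omega> (wdiv \<Omega> u) (wdiv \<Omega> u)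
      \<le> 2 * mu P / real CARD('d) * (real CARD('d) * l2_inner \<Omega> (strain \<Omega> u) (strain \<Omega> u))"
    by (intro mult_left_mono wdiv_le_strain open_dom bounded_dom assms) (use assms in simp)
  then show ?thesis by (simp add: elast_def K_dr_def add_divide_distrib algebra_simps)
qed

text \<open>With the load h = a f + b g, the energy A of d is (h, div d), so A^2 <= |h|^2 |div d|^2
  <= |h|^2 A / K_dr. The factor 2 comes from splitting |h|^2. It serves twice: for differences of
  successive errors and for the displacement error itself.\<close>

lemma elast_stability:
  fixes P :: "'d thermo_poro"
  assumes "0 < mu P" "0 \<le> lam P" "d \<in> H10v \<Omega>" "f \<in> L2 \<Omega>" "g \<in> L2 \<Omega>"
    and eq: "elast \<Omega> P d d = a * l2_inner \<Omega> f (wdiv \<Omega> d) + b * l2_inner \<Omega> g (wdiv \<Omega> d)"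
  shows "K_dr P * elast \<Omega> P d d \<le> 2 * (a\<^sup>2 * l2_inner \<Omega> f f + b\<^sup>2 * l2_inner \<Omega> g g)"
proof -
  define h where "h = (\<lambda>x. a *\<^sub>R f x + b *\<^sub>R g x)"
  have h: "h \<in> L2 \<Omega>" unfolding h_def by (intro L2_add L2_scaleR assms)
  note div = wdiv_L2[OF open_dom bounded_dom assms(3)]
  define A H D where "A = elast \<Omega> P d d" and "H = l2_inner \<Omega> h h"
    and "D = l2_inner \<Omega> (wdiv \<Omega> d) (wdiv \<Omega> d)"
  have K: "0 < K_dr P" using assms K_dr_pos by blast
  have A: "0 \<le> A" unfolding A_def using assms(1,2) by (intro elast_nonneg) simp_all
  have KD: "K_dr P * D \<le> A"
    unfolding A_def D_def using assms by (intro elast_ge_wdiv) auto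
  have "A = l2_inner \<Omega> h (wdiv \<Omega> d)"
    unfolding A_def eq h_def by (rule l2_inner_lincomb_left[symmetric, OF assms(4,5) div])
  then have "A\<^sup>2 \<le> (l2_norm \<Omega> h * l2_norm \<Omega> (wdiv \<Omega> d))\<^sup>2"
    using l2_cauchy_schwarz[OF h div] by (intro power_mono A) auto
  then have "A\<^sup>2 \<le> H * D"
    by (simp add: power_mult_distrib l2_norm_power2 H_def D_def)
  then have "K_dr P * A\<^sup>2 \<le> H * (K_dr P * D)"
    using K mult_left_mono[of "A\<^sup>2" "H * D" "K_dr P"] by (simp add: mult_ac)
  also have "\<dots> \<le> H * A"
    using KD l2_inner_nonneg[of \<Omega> h] by (intro mult_left_mono) (simp_all add: H_def)
  finally have "A * (K_dr P * A) \<le> A * H" by (simp add: power2_eq_square mult_ac)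
  have bound: "K_dr P * A \<le> H"
  proof (cases "A = 0")
    case True
    then show ?thesis by (simp add: H_def l2_inner_nonneg)
  next
    case False
    then have "0 < A" using A by simp
    with \<open>A * (K_dr P * A) \<le> A * H\<close> show ?thesis by (simp only: mult_le_cancel_left_pos)
  qed
  have "H = a\<^sup>2 * l2_inner \<Omega> f f + 2 * a * b * l2_inner \<Omega> f g + b\<^sup>2 * l2_inner \<Omega> g g"
  proof -
    have "H = a * l2_inner \<Omega> h f + b * l2_inner \<Omega> h g"
      using l2_inner_lincomb_left[OF assms(4,5) h, of a b]
      unfolding H_def h_def[symmetric] by (simp only: l2_inner_commute[of \<Omega> f] l2_inner_commute[of \<Omega> g])
    also have "l2_inner \<Omega> h f = a * l2_inner \<Omega> f f + b * l2_inner \<Omega> f g"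
      using l2_inner_lincomb_left[OF assms(4,5,4), of a b]
      unfolding h_def[symmetric] l2_inner_commute[of \<Omega> g f] .
    also have "l2_inner \<Omega> h g = a * l2_inner \<Omega> f g + b * l2_inner \<Omega> g g"
      using l2_inner_lincomb_left[OF assms(4,5,5), of a b] unfolding h_def[symmetric] .
    finally show ?thesis by (simp add: power2_eq_square algebra_simps)
  qed
  \<comment> \<open>The square of a f - b g bounds the cross term of the square of a f + b
    g.\<close>
  moreover have "0 \<le> a\<^sup>2 * l2_inner \<Omega> f f - 2 * a * b * l2_inner \<Omega> f g + b\<^sup>2 * l2_inner \<Omega> g g"
    using l2_inner_nonneg[of \<Omega> "\<lambda>x. a *\<^sub>R f x - b *\<^sub>R g x"]
      l2_inner_diff_self[OF L2_scaleR[OF assms(4), of a] L2_scaleR[OF assms(5), of b]]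
    unfolding l2_inner_scaleR_left l2_inner_scaleR_right by (simp add: power2_eq_square mult_ac)
  ultimately show ?thesis using bound unfolding A_def by simp
qed

section \<open>The error recursion\<close>

text \<open>
  The flow and the heat equation have the same structure: \<open>q\<close> stands for the unknown of the
  equation, \<open>z\<close> for the other scalar unknown.
\<close>

lemma error_step:
  fixes q q' Q qn z Z zn :: "real^'d \<Rightarrow> real"
  assumes "elliptic_tensor \<Omega> A amin amax" and "0 < t"
    and H: "q \<in> H10 \<Omega>" "q' \<in> H10 \<Omega>" "Q \<in> H10 \<Omega>" "qn \<in> H10 \<Omega>" "z \<in> H10 \<Omega>" "Z \<in> H10 \<Omega>" "zn \<in> H10 \<Omega>"
      "u \<in> H10v \<Omega>" "U \<in> H10v \<Omega>" "un \<in> H10v \<Omega>"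
    and e: "(\<lambda>x. q' x - Q x) \<in> H10 \<Omega>" "(\<lambda>x. u x - U x) \<in> H10v \<Omega>" "(\<lambda>x. (u x - un x) /\<^sub>R t) \<in> H10v \<Omega>"
    and iter: "c * l2_inner \<Omega> (\<lambda>x. (q' x - qn x) / t) (\<lambda>x. q' x - Q x)
        + l2_inner \<Omega> (\<lambda>x. A x *v wgrad \<Omega> q' x) (wgrad \<Omega> (\<lambda>x. q' x - Q x))
        + s * l2_inner \<Omega> (\<lambda>x. (q' x - q x) / t) (\<lambda>x. q' x - Q x)
      = G - a * l2_inner \<Omega> (wdiv \<Omega> (\<lambda>x. (u x - un x) /\<^sub>R t)) (\<lambda>x. q' x - Q x)
        + m * l2_inner \<Omega> (\<lambda>x. (z x - zn x) / t) (\<lambda>x. q' x - Q x)"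
    and mono: "c * l2_inner \<Omega> (\<lambda>x. (Q x - qn x) / t) (\<lambda>x. q' x - Q x)
        + a * l2_inner \<Omega> (\<lambda>x. (wdiv \<Omega> U x - wdiv \<Omega> un x) / t) (\<lambda>x. q' x - Q x)
        - m * l2_inner \<Omega> (\<lambda>x. (Z x - zn x) / t) (\<lambda>x. q' x - Q x)
        + l2_inner \<Omega> (\<lambda>x. A x *v wgrad \<Omega> Q x) (wgrad \<Omega> (\<lambda>x. q' x - Q x)) = G"
  shows "c * l2_inner \<Omega> (\<lambda>x. q' x - Q x) (\<lambda>x. q' x - Q x)
    + s * (l2_inner \<Omega> (\<lambda>x. q' x - Q x) (\<lambda>x. q' x - Q x) - l2_inner \<Omega> (\<lambda>x. q x - Q x) (\<lambda>x. q' x - Q x))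
    + a * l2_inner \<Omega> (wdiv \<Omega> (\<lambda>x. u x - U x)) (\<lambda>x. q' x - Q x)
    - m * l2_inner \<Omega> (\<lambda>x. z x - Z x) (\<lambda>x. q' x - Q x) \<le> 0"
proof -
  define w where "w = (\<lambda>x. q' x - Q x)"
  have w10: "w \<in> H10 \<Omega>" using e by (simp add: w_def)
  note H10_L2 = H10_L2[OF open_dom bounded_dom] and wgrad_L2 = wgrad_L2[OF open_dom bounded_dom]
    and wdiv_L2 = wdiv_L2[OF open_dom bounded_dom]
  note w = H10_L2[OF w10]
  note L = H(1-7)[THEN H10_L2]
  \<comment> \<open>The iteration takes the weak divergence of a difference quotient, the monolithic
    equation the quotient of weak divergences. These agree almost everywhere, so the comparison is
    made after pairing with w.\<close>
  have "l2_inner \<Omega> (wdiv \<Omega> (\<lambda>x. (u x - un x) /\<^sub>R t)) w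
      = (1/t) * l2_inner \<Omega> (wdiv \<Omega> u) w + (-1/t) * l2_inner \<Omega> (wdiv \<Omega> un) w"
    by (rule wdiv_inner_lincomb[OF H(8,10) e(3) _ w]) (simp add: fun_eq_iff scaleR_diff_right inverse_eq_divide)
  then have div1: "l2_inner \<Omega> (wdiv \<Omega> (\<lambda>x. (u x - un x) /\<^sub>R t)) w
      = (l2_inner \<Omega> (wdiv \<Omega> u) w - l2_inner \<Omega> (wdiv \<Omega> un) w) / t" by (simp add: diff_divide_distrib)
  have div2: "l2_inner \<Omega> (wdiv \<Omega> (\<lambda>x. u x - U x)) w = l2_inner \<Omega> (wdiv \<Omega> u) w - l2_inner \<Omega> (wdiv \<Omega> U) w"
    using wdiv_inner_lincomb[OF H(8,9) e(2) _ w, of 1 "-1"] by simp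
  have AL: "(\<lambda>x. A x *v v x) \<in> L2 \<Omega>" if "v \<in> L2 \<Omega>" for v
    using elliptic_tensor_L2[OF open_dom bounded_dom assms(1) that] .
  have AE: "AE x in lebesgue_on \<Omega>. wgrad \<Omega> w x = wgrad \<Omega> q' x - wgrad \<Omega> Q x"
    using wgrad_lincomb[OF open_dom bounded_dom H(2,3), of 1 "-1"] e(1) by (simp add: w_def)
  have "l2_inner \<Omega> (\<lambda>x. A x *v wgrad \<Omega> w x) (wgrad \<Omega> w)
      = 1 * l2_inner \<Omega> (\<lambda>x. A x *v wgrad \<Omega> q' x) (wgrad \<Omega> w)
        + (-1) * l2_inner \<Omega> (\<lambda>x. A x *v wgrad \<Omega> Q x) (wgrad \<Omega> w)"
  proof (rule l2_inner_AE_lincomb)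
    show "AE x in lebesgue_on \<Omega>. A x *v wgrad \<Omega> w x
        = 1 *\<^sub>R (A x *v wgrad \<Omega> q' x) + (-1) *\<^sub>R (A x *v wgrad \<Omega> Q x)"
      using AE by eventually_elim (simp add: matrix_vector_mult_diff_distrib)
  qed (intro AL wgrad_L2 H w10)+
  moreover have "0 \<le> l2_inner \<Omega> (\<lambda>x. A x *v wgrad \<Omega> w x) (wgrad \<Omega> w)"
    by (rule elliptic_tensor_nonneg[OF open_dom bounded_dom assms(1)])
  \<comment> \<open>The diffusion term of the error is kept only through its sign; this turns the
    difference of the two equations into an inequality.\<close>
  ultimately have ell: "l2_inner \<Omega> (\<lambda>x. A x *v wgrad \<Omega> Q x) (wgrad \<Omega> w)
      \<le> l2_inner \<Omega> (\<lambda>x. A x *v wgrad \<Omega> q' x) (wgrad \<Omega> w)" by simp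
  \<comment> \<open>With r in place of division by t both equations are polynomial, so subtracting
    them is ring arithmetic; r > 0 is cancelled at the end.\<close>
  define r where "r = 1 / t"
  have r: "0 < r" "\<And>y. y / t = r * y" using assms(2) by (simp_all add: r_def)
  note expand = l2_inner_div_diff_left[OF L(2) L(4) w] l2_inner_div_diff_left[OF L(2) L(1) w]
    l2_inner_div_diff_left[OF L(5) L(7) w] l2_inner_div_diff_left[OF L(3) L(4) w]
    l2_inner_div_diff_left[OF L(6) L(7) w]
    l2_inner_div_diff_left[OF wdiv_L2[OF H(9)] wdiv_L2[OF H(10)] w] div1
  have iter': "c * (r * (l2_inner \<Omega> q' w - l2_inner \<Omega> qn w))
        + l2_inner \<Omega> (\<lambda>x. A x *v wgrad \<Omega> q' x) (wgrad \<Omega> w)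
        + s * (r * (l2_inner \<Omega> q' w - l2_inner \<Omega> q w))
      = G - a * (r * (l2_inner \<Omega> (wdiv \<Omega> u) w - l2_inner \<Omega> (wdiv \<Omega> un) w))
        + m * (r * (l2_inner \<Omega> z w - l2_inner \<Omega> zn w))"
    using iter[folded w_def] unfolding expand unfolding r(2) .
  have mono': "c * (r * (l2_inner \<Omega> Q w - l2_inner \<Omega> qn w))
        + a * (r * (l2_inner \<Omega> (wdiv \<Omega> U) w - l2_inner \<Omega> (wdiv \<Omega> un) w))
        - m * (r * (l2_inner \<Omega> Z w - l2_inner \<Omega> zn w))
        + l2_inner \<Omega> (\<lambda>x. A x *v wgrad \<Omega> Q x) (wgrad \<Omega> w) = G"
    using mono[folded w_def] unfolding expand unfolding r(2) .
  have ww: "l2_inner \<Omega> w w = l2_inner \<Omega> q' w - l2_inner \<Omega> Q w"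
    using l2_inner_diff_left[OF L(2,3) w] by (simp add: w_def)
  have "r * (c * l2_inner \<Omega> w w
      + s * (l2_inner \<Omega> w w - l2_inner \<Omega> (\<lambda>x. q x - Q x) w)
      + a * l2_inner \<Omega> (wdiv \<Omega> (\<lambda>x. u x - U x)) w
      - m * l2_inner \<Omega> (\<lambda>x. z x - Z x) w) \<le> r * 0"
    unfolding ww div2 l2_inner_diff_left[OF L(1,3) w] l2_inner_diff_left[OF L(5,6) w]
    using iter' mono' ell by (simp add: algebra_simps)
  then show ?thesis using r(1) by (simp only: mult_le_cancel_left_pos w_def)
qed

text \<open>
  Polarization: the form \<open>T = S - A\<close> satisfies \<open>-S \<le> T \<le> S\<close> because \<open>0 \<le> A \<le> 2 S\<close>, hence
  \<open>2 T(e, e') \<le> S(e, e) + S(e', e')\<close>. Here \<open>S\<close> is the stabilization, with entries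
  \<open>P, PP, P'\<close> and \<open>H, HH, H'\<close>, and \<open>A\<close> is the coupling through the displacement.
\<close>

lemma energy_decay_arith:
  fixes P P' PP H H' HH A A' AA :: real
  assumes "c * P' + s1 * (P' - PP) + X - m * Y \<le> 0"
    and "c' * H' + s2 * (H' - HH) + X' - m * Y' \<le> 0"
    and "AA = X + X'"
    and "0 \<le> A + 2 * AA + A'"
    and "A - 2 * AA + A' \<le> 2 * (s1 * (P - 2 * PP + P') + s2 * (H - 2 * HH + H'))"
    and "0 \<le> m" "2 * Y \<le> H + P'" "2 * Y' \<le> P + H'"
  shows "(s1 + m) / 2 * P' + (s2 + m) / 2 * H' + ((c - m) * P' + (c' - m) * H')
    \<le> (s1 + m) / 2 * P + (s2 + m) / 2 * H"
proof -
  \<comment> \<open>Each lagged pressure-temperature product is split evenly between an old and a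
    new square, whence the weight m / 2 on both unknowns in the energy.\<close>
  have "m * (2 * Y) \<le> m * (H + P')" "m * (2 * Y') \<le> m * (P + H')"
    using assms(6-8) by (auto intro: mult_left_mono)
  \<comment> \<open>Adding the fourth and fifth assumptions cancels \<open>A\<close> and
    \<open>A'\<close> and bounds \<open>s1 * PP + s2 * HH - AA\<close> by half the sum of the old
    and new stabilization energies.\<close>
  with assms(1-5) show ?thesis by (simp add: field_simps)
qed

text \<open>A decreasing nonnegative sequence converges, so its increments, which dominate X, tend
  to 0.\<close>

lemma decay_tendsto_0:
  fixes E X :: "nat \<Rightarrow> real"
  assumes "\<And>i. 0 \<le> E i" "\<And>i. 0 \<le> X i" "\<And>i. E (Suc i) + X i \<le> E i"
  shows "X \<longlonglongrightarrow> 0"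
proof -
  have "E (Suc i) \<le> E i" for i
    using assms(2,3)[of i] by linarith
  then have "decseq E" by (rule decseq_SucI)
  moreover have "\<forall>i. 0 \<le> E i" using assms(1) by simp
  ultimately obtain l where l: "E \<longlonglongrightarrow> l" by (rule decseq_convergent)
  have "(\<lambda>i. E i - E (Suc i)) \<longlonglongrightarrow> l - l"
    by (intro tendsto_diff l LIMSEQ_Suc)
  then have lim: "(\<lambda>i. E i - E (Suc i)) \<longlonglongrightarrow> 0" by simp
  show ?thesis
  proof (rule Lim_null_comparison[OF always_eventually lim], rule allI)
    fix i show "norm (X i) \<le> E i - E (Suc i)" using assms(2,3)[of i] by simp
  qed
qed

lemma square_diff_bound:
  assumes "f \<in> L2 \<Omega>" "g \<in> L2 \<Omega>"
  shows "2 * l2_inner \<Omega> f g \<le> l2_inner \<Omega> f f + l2_inner \<Omega> g g"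
  using l2_inner_nonneg[of \<Omega> "\<lambda>x. f x - g x"] l2_inner_diff_self[OF assms] by simp

text \<open>Closure under linear combinations makes the errors, and the differences and sums of
  successive errors, admissible test functions; this is what carries the energy argument to any such
  triple of spaces.\<close>

lemma fixed_stress_tendsto_monolithic:
  fixes P :: "'d thermo_poro" and V :: "(real^'d \<Rightarrow> real^'d) set" and W Th :: "(real^'d \<Rightarrow> real) set"
  assumes par: "0 < mu P" "0 \<le> lam P" "0 \<le> alpha_m P" "0 < theta0 P" "1 \<le> stab_L P" "0 < dt P"
      "3 * alpha_m P < storage_c0 P" "3 * alpha_m P * theta0 P < heat_C P"
    and ell: "elliptic_tensor \<Omega> (perm P) kmin kmax" "elliptic_tensor \<Omega> (cond P) dmin dmax"
    and sub: "V \<subseteq> H10v \<Omega>" "W \<subseteq> H10 \<Omega>" "Th \<subseteq> H10 \<Omega>"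
    and V: "\<And>a b f g. f \<in> V \<Longrightarrow> g \<in> V \<Longrightarrow> (\<lambda>x. a *\<^sub>R f x + b *\<^sub>R g x) \<in> V"
    and W: "\<And>a b f g. f \<in> W \<Longrightarrow> g \<in> W \<Longrightarrow> (\<lambda>x. a *\<^sub>R f x + b *\<^sub>R g x) \<in> W"
    and Th: "\<And>a b f g. f \<in> Th \<Longrightarrow> g \<in> Th \<Longrightarrow> (\<lambda>x. a *\<^sub>R f x + b *\<^sub>R g x) \<in> Th"
    and mono: "monolithic_step \<Omega> P V W Th t un pn \<theta>n U Q \<Theta>"
    and iter: "fixed_stress \<Omega> P V W Th t un pn \<theta>n u p \<theta>"
  shows "(\<lambda>i. h1v_norm \<Omega> (\<lambda>x. u i x - U x)) \<longlonglongrightarrow> 0"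
    and "(\<lambda>i. l2_norm \<Omega> (\<lambda>x. p i x - Q x)) \<longlonglongrightarrow> 0"
    and "(\<lambda>i. l2_norm \<Omega> (\<lambda>x. \<theta> i x - \<Theta> x)) \<longlonglongrightarrow> 0"
proof -
  have V_diff: "(\<lambda>x. f x - g x) \<in> V" if "f \<in> V" "g \<in> V" for f g
    using V[OF that, of 1 "-1"] by simp
  have W_diff: "(\<lambda>x. f x - g x) \<in> W" if "f \<in> W" "g \<in> W" for f g
    using W[OF that, of 1 "-1"] by simp
  have Th_diff: "(\<lambda>x. f x - g x) \<in> Th" if "f \<in> Th" "g \<in> Th" for f g
    using Th[OF that, of 1 "-1"] by simp
  have VH: "f \<in> H10v \<Omega>" if "f \<in> V" for f using that sub by blast
  have WH: "f \<in> H10 \<Omega>" if "f \<in> W" for f using that sub by blast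
  have ThH: "f \<in> H10 \<Omega>" if "f \<in> Th" for f using that sub by blast
  have n: "un \<in> V" "pn \<in> W" "\<theta>n \<in> Th" "U \<in> V" "Q \<in> W" "\<Theta> \<in> Th"
    using mono by (auto simp: monolithic_step_def)
  have u: "u i \<in> V" and p: "p i \<in> W" and \<theta>: "\<theta> i \<in> Th" for i
    using iter by (cases i; auto simp: fixed_stress_def)+
  define \<alpha> \<beta> K s1 s2 m c c' where "\<alpha> = biot_alpha P" and "\<beta> = 3 * alpha_T P * K_dr P" and "K = K_dr P"
    and "s1 = stab_L P * (\<alpha>\<^sup>2 / K)" and "s2 = stab_L P * (\<beta>\<^sup>2 / K)" and "m = 3 * alpha_m P"
    and "c = storage_c0 P" and "c' = heat_C P / theta0 P"
  have K: "0 < K" unfolding K_def using par by (intro K_dr_pos)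
  \<comment> \<open>Since \<beta> = 3 alpha_T K_dr, the heat stabilization 9 L alpha_T^2 K_dr is L
    \<beta>^2 / K_dr, the same shape as in the flow equation.\<close>
  have s2': "9 * stab_L P * (alpha_T P)\<^sup>2 * K_dr P * theta0 P = theta0 P * s2"
    using K by (simp add: s2_def \<beta>_def K_def power2_eq_square)
  have m: "0 \<le> m" "m < c" "m < c'"
    using par by (simp_all add: m_def c_def c'_def field_simps)
  have s: "0 \<le> s1" "0 \<le> s2" using par K by (simp_all add: s1_def s2_def)
  define eu ep eh where "eu = (\<lambda>i x. u i x - U x)" and "ep = (\<lambda>i x. p i x - Q x)"
    and "eh = (\<lambda>i x. \<theta> i x - \<Theta> x)"
  have eu: "eu i \<in> V" and ep: "ep i \<in> W" and eh: "eh i \<in> Th" for i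
    unfolding eu_def ep_def eh_def by (intro V_diff W_diff Th_diff u p \<theta> n)+
  have epL: "ep i \<in> L2 \<Omega>" and ehL: "eh i \<in> L2 \<Omega>" for i
    using H10_L2[OF open_dom bounded_dom] WH[OF ep] ThH[OF eh] by blast+
  have pL: "p i \<in> L2 \<Omega>" "\<theta> i \<in> L2 \<Omega>" "Q \<in> L2 \<Omega>" "\<Theta> \<in> L2 \<Omega>" for i
    using H10_L2[OF open_dom bounded_dom] WH[OF p] ThH[OF \<theta>] WH[OF n(5)] ThH[OF n(6)] by blast+
  have divL: "wdiv \<Omega> v \<in> L2 \<Omega>" if "v \<in> V" for v
    by (rule wdiv_L2[OF open_dom bounded_dom VH[OF that]])
  have dq: "(\<lambda>x. (u i x - un x) /\<^sub>R dt P) \<in> V" for i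
    using V[OF V_diff[OF u[of i] n(1)] n(1), of "1 / dt P" 0] by (simp add: inverse_eq_divide)

  \<comment> \<open>Available only for iterates produced by Step 3: the initial guess need not
    satisfy a mechanics equation. Hence the energy is followed from index 1 on.\<close>
  have mech: "elast \<Omega> P (eu (Suc i)) v
      = \<alpha> * l2_inner \<Omega> (ep (Suc i)) (wdiv \<Omega> v) + \<beta> * l2_inner \<Omega> (eh (Suc i)) (wdiv \<Omega> v)"
    if v: "v \<in> V" for i v
  proof -
    have "elast \<Omega> P (u (Suc i)) v = l2_inner \<Omega> (body_force P t) v
        + \<alpha> * l2_inner \<Omega> (p (Suc i)) (wdiv \<Omega> v) + \<beta> * l2_inner \<Omega> (\<theta> (Suc i)) (wdiv \<Omega> v)"
      using iter v by (simp add: fixed_stress_def elast_def \<alpha>_def \<beta>_def)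
    moreover have "elast \<Omega> P U v - \<alpha> * l2_inner \<Omega> Q (wdiv \<Omega> v) - \<beta> * l2_inner \<Omega> \<Theta> (wdiv \<Omega> v)
        = l2_inner \<Omega> (body_force P t) v"
      using mono v by (simp add: monolithic_step_def elast_def \<alpha>_def \<beta>_def)
    moreover have de: "elast \<Omega> P (eu (Suc i)) v = 1 * elast \<Omega> P (u (Suc i)) v + (-1) * elast \<Omega> P U v"
      by (intro elast_lincomb VH u n eu v) (simp add: eu_def)
    have dp: "l2_inner \<Omega> (ep (Suc i)) (wdiv \<Omega> v) = l2_inner \<Omega> (p (Suc i)) (wdiv \<Omega> v) - l2_inner \<Omega> Q (wdiv \<Omega> v)"
      unfolding ep_def by (intro l2_inner_diff_left pL divL v)
    have dh: "l2_inner \<Omega> (eh (Suc i)) (wdiv \<Omega> v) = l2_inner \<Omega> (\<theta> (Suc i)) (wdiv \<Omega> v) - l2_inner \<Omega> \<Theta> (wdiv \<Omega> v)"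
      unfolding eh_def by (intro l2_inner_diff_left pL divL v)
    ultimately show ?thesis using de unfolding dp dh by (simp add: algebra_simps)
  qed

  have flow: "c * l2_inner \<Omega> (ep (Suc i)) (ep (Suc i))
      + s1 * (l2_inner \<Omega> (ep (Suc i)) (ep (Suc i)) - l2_inner \<Omega> (ep i) (ep (Suc i)))
      + \<alpha> * l2_inner \<Omega> (wdiv \<Omega> (eu i)) (ep (Suc i)) - m * l2_inner \<Omega> (eh i) (ep (Suc i)) \<le> 0" for i
    unfolding ep_def eh_def eu_def
  proof (rule error_step[OF ell(1) par(6) WH[OF p] WH[OF p] WH[OF n(5)] WH[OF n(2)] ThH[OF \<theta>] ThH[OF n(6)]
        ThH[OF n(3)] VH[OF u] VH[OF n(4)] VH[OF n(1)] WH[OF ep[unfolded ep_def]] VH[OF eu[unfolded eu_def]] VH[OF dq]])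
    show "c * l2_inner \<Omega> (\<lambda>x. (p (Suc i) x - pn x) / dt P) (\<lambda>x. p (Suc i) x - Q x)
        + l2_inner \<Omega> (\<lambda>x. perm P x *v wgrad \<Omega> (p (Suc i)) x) (wgrad \<Omega> (\<lambda>x. p (Suc i) x - Q x))
        + s1 * l2_inner \<Omega> (\<lambda>x. (p (Suc i) x - p i x) / dt P) (\<lambda>x. p (Suc i) x - Q x)
      = l2_inner \<Omega> (fluid_src P t) (\<lambda>x. p (Suc i) x - Q x)
        - \<alpha> * l2_inner \<Omega> (wdiv \<Omega> (\<lambda>x. (u i x - un x) /\<^sub>R dt P)) (\<lambda>x. p (Suc i) x - Q x)
        + m * l2_inner \<Omega> (\<lambda>x. (\<theta> i x - \<theta>n x) / dt P) (\<lambda>x. p (Suc i) x - Q x)"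
      using iter ep[of "Suc i", unfolded ep_def]
      unfolding fixed_stress_def c_def s1_def \<alpha>_def m_def K_def by blast
    show "c * l2_inner \<Omega> (\<lambda>x. (Q x - pn x) / dt P) (\<lambda>x. p (Suc i) x - Q x)
        + \<alpha> * l2_inner \<Omega> (\<lambda>x. (wdiv \<Omega> U x - wdiv \<Omega> un x) / dt P) (\<lambda>x. p (Suc i) x - Q x)
        - m * l2_inner \<Omega> (\<lambda>x. (\<Theta> x - \<theta>n x) / dt P) (\<lambda>x. p (Suc i) x - Q x)
        + l2_inner \<Omega> (\<lambda>x. perm P x *v wgrad \<Omega> Q x) (wgrad \<Omega> (\<lambda>x. p (Suc i) x - Q x))
      = l2_inner \<Omega> (fluid_src P t) (\<lambda>x. p (Suc i) x - Q x)"
      using mono ep[of "Suc i", unfolded ep_def]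
      unfolding monolithic_step_def c_def \<alpha>_def m_def by blast
  qed

  have heat': "heat_C P * l2_inner \<Omega> (eh (Suc i)) (eh (Suc i))
      + (9 * stab_L P * (alpha_T P)\<^sup>2 * K_dr P * theta0 P)
        * (l2_inner \<Omega> (eh (Suc i)) (eh (Suc i)) - l2_inner \<Omega> (eh i) (eh (Suc i)))
      + (3 * alpha_T P * K_dr P * theta0 P) * l2_inner \<Omega> (wdiv \<Omega> (eu i)) (eh (Suc i))
      - (3 * alpha_m P * theta0 P) * l2_inner \<Omega> (ep i) (eh (Suc i)) \<le> 0" for i
    unfolding ep_def eh_def eu_def
  proof (rule error_step[OF ell(2) par(6) ThH[OF \<theta>] ThH[OF \<theta>] ThH[OF n(6)] ThH[OF n(3)] WH[OF p] WH[OF n(5)]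
        WH[OF n(2)] VH[OF u] VH[OF n(4)] VH[OF n(1)] ThH[OF eh[unfolded eh_def]] VH[OF eu[unfolded eu_def]] VH[OF dq]])
    let ?s = "\<lambda>x. \<theta> (Suc i) x - \<Theta> x"
    have "heat_C P * l2_inner \<Omega> (\<lambda>x. (\<theta> (Suc i) x - \<theta>n x) / dt P) ?s
        + l2_inner \<Omega> (\<lambda>x. cond P x *v wgrad \<Omega> (\<theta> (Suc i)) x) (wgrad \<Omega> ?s)
        + 9 * stab_L P * (alpha_T P)\<^sup>2 * K_dr P * theta0 P * l2_inner \<Omega> (\<lambda>x. (\<theta> (Suc i) x - \<theta> i x) / dt P) ?s
      = l2_inner \<Omega> (heat_src P t) ?s
        + 3 * alpha_m P * theta0 P * l2_inner \<Omega> (\<lambda>x. (p i x - pn x) / dt P) ?s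
        - 3 * alpha_T P * K_dr P * theta0 P * l2_inner \<Omega> (wdiv \<Omega> (\<lambda>x. (u i x - un x) /\<^sub>R dt P)) ?s"
      using iter eh[of "Suc i", unfolded eh_def] unfolding fixed_stress_def by blast
    then show "heat_C P * l2_inner \<Omega> (\<lambda>x. (\<theta> (Suc i) x - \<theta>n x) / dt P) ?s
        + l2_inner \<Omega> (\<lambda>x. cond P x *v wgrad \<Omega> (\<theta> (Suc i)) x) (wgrad \<Omega> ?s)
        + 9 * stab_L P * (alpha_T P)\<^sup>2 * K_dr P * theta0 P * l2_inner \<Omega> (\<lambda>x. (\<theta> (Suc i) x - \<theta> i x) / dt P) ?s
      = l2_inner \<Omega> (heat_src P t) ?s
        - 3 * alpha_T P * K_dr P * theta0 P * l2_inner \<Omega> (wdiv \<Omega> (\<lambda>x. (u i x - un x) /\<^sub>R dt P)) ?s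
        + 3 * alpha_m P * theta0 P * l2_inner \<Omega> (\<lambda>x. (p i x - pn x) / dt P) ?s"
      by linarith
    show "heat_C P * l2_inner \<Omega> (\<lambda>x. (\<Theta> x - \<theta>n x) / dt P) ?s
        + 3 * alpha_T P * K_dr P * theta0 P * l2_inner \<Omega> (\<lambda>x. (wdiv \<Omega> U x - wdiv \<Omega> un x) / dt P) ?s
        - 3 * alpha_m P * theta0 P * l2_inner \<Omega> (\<lambda>x. (Q x - pn x) / dt P) ?s
        + l2_inner \<Omega> (\<lambda>x. cond P x *v wgrad \<Omega> \<Theta> x) (wgrad \<Omega> ?s)
      = l2_inner \<Omega> (heat_src P t) ?s"
      using mono eh[of "Suc i", unfolded eh_def] unfolding monolithic_step_def by blast
  qed
  \<comment> \<open>After division by \<open>theta0 P\<close> > 0 the coupling coefficients are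
    \<open>m\<close>, as in the flow inequality, and \<beta>, as in the mechanics equation.\<close>
  have heat: "c' * l2_inner \<Omega> (eh (Suc i)) (eh (Suc i))
      + s2 * (l2_inner \<Omega> (eh (Suc i)) (eh (Suc i)) - l2_inner \<Omega> (eh i) (eh (Suc i)))
      + \<beta> * l2_inner \<Omega> (wdiv \<Omega> (eu i)) (eh (Suc i)) - m * l2_inner \<Omega> (ep i) (eh (Suc i)) \<le> 0"
    (is "?l \<le> 0") for i
  proof -
    have "heat_C P = theta0 P * c'" using par by (simp add: c'_def)
    then have "theta0 P * ?l \<le> theta0 P * 0"
      using heat'[of i] unfolding s2' by (simp add: \<beta>_def m_def algebra_simps)
    then show ?thesis using par(4) by (simp only: mult_le_cancel_left_pos)
  qed

  define EP EH EA where "EP = (\<lambda>i. l2_inner \<Omega> (ep i) (ep i))" and "EH = (\<lambda>i. l2_inner \<Omega> (eh i) (eh i))"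
    and "EA = (\<lambda>i. elast \<Omega> P (eu i) (eu i))"
  have step: "(s1 + m) / 2 * EP (Suc (Suc i)) + (s2 + m) / 2 * EH (Suc (Suc i))
      + ((c - m) * EP (Suc (Suc i)) + (c' - m) * EH (Suc (Suc i)))
      \<le> (s1 + m) / 2 * EP (Suc i) + (s2 + m) / 2 * EH (Suc i)" for i
  proof -
    define j k where "j = Suc i" and "k = Suc (Suc i)"
    define AA where "AA = elast \<Omega> P (eu k) (eu j)"
    define d where "d = (\<lambda>x. eu k x - eu j x)"
    define w where "w = (\<lambda>x. eu k x + eu j x)"
    have d: "d \<in> V" unfolding d_def by (intro V_diff eu)
    have w: "w \<in> V" using V[OF eu eu, of 1 k 1 j] by (simp add: w_def)
    have lin_d: "elast \<Omega> P d z = elast \<Omega> P (eu k) z - elast \<Omega> P (eu j) z" if "z \<in> V" for z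
      using elast_lincomb[OF VH[OF eu] VH[OF eu] VH[OF d] _ VH[OF that], of 1 k "-1" j] by (simp add: d_def)
    have lin_w: "elast \<Omega> P w z = elast \<Omega> P (eu k) z + elast \<Omega> P (eu j) z" if "z \<in> V" for z
      using elast_lincomb[OF VH[OF eu] VH[OF eu] VH[OF w] _ VH[OF that], of 1 k 1 j] by (simp add: w_def)
    have dd: "elast \<Omega> P d d = EA j - 2 * AA + EA k"
      using lin_d[OF d] lin_d[OF eu[of k]] lin_d[OF eu[of j]]
        elast_commute[of \<Omega> P "eu k" d] elast_commute[of \<Omega> P "eu j" d] elast_commute[of \<Omega> P "eu j" "eu k"]
      unfolding EA_def AA_def by linarith
    have ww: "elast \<Omega> P w w = EA j + 2 * AA + EA k"
      using lin_w[OF w] lin_w[OF eu[of k]] lin_w[OF eu[of j]]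
        elast_commute[of \<Omega> P "eu k" w] elast_commute[of \<Omega> P "eu j" w] elast_commute[of \<Omega> P "eu j" "eu k"]
      unfolding EA_def AA_def by linarith
    let ?dp = "\<lambda>x. ep k x - ep j x" and ?dh = "\<lambda>x. eh k x - eh j x"
    \<comment> \<open>The difference of successive displacement errors is driven by the differences
      of the scalar errors, so the stability bound controls A(x, x) for x = e_k - e_j.\<close>
    have "elast \<Omega> P d d = \<alpha> * l2_inner \<Omega> ?dp (wdiv \<Omega> d) + \<beta> * l2_inner \<Omega> ?dh (wdiv \<Omega> d)"
      unfolding lin_d[OF d] j_def k_def mech[OF d] l2_inner_diff_left[OF epL epL divL[OF d]]
        l2_inner_diff_left[OF ehL ehL divL[OF d]]
      by (simp add: algebra_simps)
    from elast_stability[OF par(1,2) VH[OF d] L2_diff[OF epL epL] L2_diff[OF ehL ehL] this]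
    have "elast \<Omega> P d d \<le> 2 * (\<alpha>\<^sup>2 / K * l2_inner \<Omega> ?dp ?dp + \<beta>\<^sup>2 / K * l2_inner \<Omega> ?dh ?dh)"
      using K by (simp add: K_def[symmetric] field_simps)
    also have "\<dots> \<le> 2 * (s1 * l2_inner \<Omega> ?dp ?dp + s2 * l2_inner \<Omega> ?dh ?dh)"
    proof -
      \<comment> \<open>Here L >= 1 lets the stabilization absorb the stability bound.\<close>
      have "1 * (x\<^sup>2 / K) \<le> stab_L P * (x\<^sup>2 / K)" for x
        using par(5) K by (intro mult_right_mono) simp_all
      then have "\<alpha>\<^sup>2 / K \<le> s1" "\<beta>\<^sup>2 / K \<le> s2" unfolding s1_def s2_def by (simp_all only: mult_1)
      then show ?thesis by (intro mult_left_mono add_mono mult_right_mono l2_inner_nonneg) auto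
    qed
    finally have diff: "EA j - 2 * AA + EA k \<le> 2 * (s1 * (EP j - 2 * l2_inner \<Omega> (ep j) (ep k) + EP k)
        + s2 * (EH j - 2 * l2_inner \<Omega> (eh j) (eh k) + EH k))"
      unfolding dd l2_inner_diff_self[OF epL epL] l2_inner_diff_self[OF ehL ehL]
      unfolding l2_inner_commute[of \<Omega> "ep k" "ep j"] l2_inner_commute[of \<Omega> "eh k" "eh j"]
      by (simp add: EP_def EH_def algebra_simps)
    have sum: "0 \<le> EA j + 2 * AA + EA k"
      unfolding ww[symmetric] using par by (intro elast_nonneg) simp_all
    \<comment> \<open>The mechanics equation of the new error, tested with the old displacement
      error, is the sum of the two displacement couplings in \<open>flow\<close> and
      \<open>heat\<close>.\<close>
    have AA: "AA = \<alpha> * l2_inner \<Omega> (wdiv \<Omega> (eu j)) (ep k) + \<beta> * l2_inner \<Omega> (wdiv \<Omega> (eu j)) (eh k)"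
      unfolding AA_def k_def mech[OF eu] by (simp add: l2_inner_commute)
    show ?thesis
      using energy_decay_arith[OF flow[of j] heat[of j] AA[unfolded k_def, folded j_def]]
        diff sum m(1) square_diff_bound[OF ehL[of j] epL[of k]] square_diff_bound[OF epL[of j] ehL[of k]]
      unfolding EP_def EH_def j_def k_def by blast
  qed
  have nonneg: "0 \<le> EP i" "0 \<le> EH i" for i
    by (simp_all add: EP_def EH_def l2_inner_nonneg)
  let ?X = "\<lambda>i. (c - m) * EP (Suc (Suc i)) + (c' - m) * EH (Suc (Suc i))"
  have X: "?X \<longlonglongrightarrow> 0"
  proof (rule decay_tendsto_0)
    show "0 \<le> (s1 + m) / 2 * EP (Suc i) + (s2 + m) / 2 * EH (Suc i)" "0 \<le> ?X i" for i
      using m s nonneg by simp_all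
  qed (rule step)
  have EP: "EP \<longlonglongrightarrow> 0"
  \<comment> \<open>\<open>?X i\<close> is the dissipation at the newer of the errors i + 1 and i +
    2, hence the shift by 2.\<close>
  proof (rule LIMSEQ_offset[where k = 2], rule Lim_null_comparison[OF always_eventually])
    show "(\<lambda>i. ?X i / (c - m)) \<longlonglongrightarrow> 0" using tendsto_divide_zero[OF X] .
    show "\<forall>i. norm (EP (i + 2)) \<le> ?X i / (c - m)"
    proof
      fix i
      have "0 \<le> (c - m) * EP (Suc (Suc i))" "0 \<le> (c' - m) * EH (Suc (Suc i))"
        using m nonneg by simp_all
      then have "EP (Suc (Suc i)) * (c - m) \<le> ?X i" by (simp add: mult.commute)
      then show "norm (EP (i + 2)) \<le> ?X i / (c - m)"
        using m nonneg[of "Suc (Suc i)"] by (simp add: pos_le_divide_eq)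
    qed
  qed
  have EH: "EH \<longlonglongrightarrow> 0"
  proof (rule LIMSEQ_offset[where k = 2], rule Lim_null_comparison[OF always_eventually])
    show "(\<lambda>i. ?X i / (c' - m)) \<longlonglongrightarrow> 0" using tendsto_divide_zero[OF X] .
    show "\<forall>i. norm (EH (i + 2)) \<le> ?X i / (c' - m)"
    proof
      fix i
      have "0 \<le> (c - m) * EP (Suc (Suc i))" "0 \<le> (c' - m) * EH (Suc (Suc i))"
        using m nonneg by simp_all
      then have "EH (Suc (Suc i)) * (c' - m) \<le> ?X i" by (simp add: mult.commute)
      then show "norm (EH (i + 2)) \<le> ?X i / (c' - m)"
        using m nonneg[of "Suc (Suc i)"] by (simp add: pos_le_divide_eq)
    qed
  qed
  obtain C where C: "0 \<le> C"
    "\<And>u. u \<in> H10v \<Omega> \<Longrightarrow> h1v_inner \<Omega> u u \<le> C * l2_inner \<Omega> (strain \<Omega> u) (strain \<Omega> u)"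
    using h1v_le_strain[OF open_dom bounded_dom] by blast
  have "(\<lambda>i. h1v_inner \<Omega> (eu i) (eu i)) \<longlonglongrightarrow> 0"
  \<comment> \<open>The shift by 1 again skips the initial guess. The chain passes from the H^1 norm
    to the strain, to the elastic energy, and through the stability bound to the pressure and
    temperature errors.\<close>
  proof (rule LIMSEQ_offset[where k = 1], rule Lim_null_comparison[OF always_eventually], rule allI)
    fix i
    have "h1v_inner \<Omega> (eu (Suc i)) (eu (Suc i))
        \<le> C * l2_inner \<Omega> (strain \<Omega> (eu (Suc i))) (strain \<Omega> (eu (Suc i)))"
      by (intro C VH eu)
    also have "\<dots> \<le> C * (EA (Suc i) / (2 * mu P))"
      unfolding EA_def using elast_ge_strain[OF par(2), of "eu (Suc i)"] par
      by (intro mult_left_mono C) (simp add: field_simps)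
    also have "\<dots> \<le> C * (2 * (\<alpha>\<^sup>2 * EP (Suc i) + \<beta>\<^sup>2 * EH (Suc i)) / K / (2 * mu P))"
    proof (intro mult_left_mono divide_right_mono C)
      show "EA (Suc i) \<le> 2 * (\<alpha>\<^sup>2 * EP (Suc i) + \<beta>\<^sup>2 * EH (Suc i)) / K"
        using elast_stability[OF par(1,2) VH[OF eu] epL ehL mech[OF eu]] K
        by (simp add: EA_def EP_def EH_def K_def field_simps)
    qed (use par in simp)
    finally show "norm (h1v_inner \<Omega> (eu (i + 1)) (eu (i + 1)))
        \<le> C * (2 * (\<alpha>\<^sup>2 * EP (i + 1) + \<beta>\<^sup>2 * EH (i + 1)) / K / (2 * mu P))"
      by (simp add: h1v_inner_def l2_inner_nonneg)
  next
    have "(\<lambda>i. C * (2 * (\<alpha>\<^sup>2 * EP (i + 1) + \<beta>\<^sup>2 * EH (i + 1)) / K / (2 * mu P)))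
        \<longlonglongrightarrow> C * (2 * (\<alpha>\<^sup>2 * 0 + \<beta>\<^sup>2 * 0) / K / (2 * mu P))"
      using par K by (intro tendsto_intros LIMSEQ_ignore_initial_segment EP EH) auto
    then show "(\<lambda>i. C * (2 * (\<alpha>\<^sup>2 * EP (i + 1) + \<beta>\<^sup>2 * EH (i + 1)) / K / (2 * mu P))) \<longlonglongrightarrow> 0"
      by simp
  qed
  from tendsto_real_sqrt[OF this] show "(\<lambda>i. h1v_norm \<Omega> (\<lambda>x. u i x - U x)) \<longlonglongrightarrow> 0"
    by (simp add: h1v_norm_def eu_def)
  from tendsto_real_sqrt[OF EP] show "(\<lambda>i. l2_norm \<Omega> (\<lambda>x. p i x - Q x)) \<longlonglongrightarrow> 0"
    by (simp add: l2_norm_def EP_def ep_def)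
  from tendsto_real_sqrt[OF EH] show "(\<lambda>i. l2_norm \<Omega> (\<lambda>x. \<theta> i x - \<Theta> x)) \<longlonglongrightarrow> 0"
    by (simp add: l2_norm_def EH_def eh_def)
qed

end

section \<open>Reduced basis spaces\<close>

lemma lin_span_lincomb:
  assumes "f \<in> lin_span m b" "g \<in> lin_span m b"
  shows "(\<lambda>x. r *\<^sub>R f x + s *\<^sub>R g x) \<in> lin_span m b"
proof -
  obtain c d where "f = (\<lambda>x. \<Sum>k<m. c k *\<^sub>R b k x)" "g = (\<lambda>x. \<Sum>k<m. d k *\<^sub>R b k x)"
    using assms by (auto simp: lin_span_def)
  then have "(\<lambda>x. r *\<^sub>R f x + s *\<^sub>R g x) = (\<lambda>x. \<Sum>k<m. (r * c k + s * d k) *\<^sub>R b k x)"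
    by (simp add: scaleR_sum_right sum.distrib scaleR_left_distrib)
  then show ?thesis
    unfolding lin_span_def by (intro CollectI exI[of _ "\<lambda>k. r * c k + s * d k"])
qed

lemma lin_span_sum:
  assumes "finite I" "\<And>i. i \<in> I \<Longrightarrow> f i \<in> lin_span m b"
  shows "(\<lambda>x. \<Sum>i\<in>I. c i *\<^sub>R f i x) \<in> lin_span m b"
  using assms
proof (induction I rule: finite_induct)
  case empty
  show ?case unfolding lin_span_def by (intro CollectI exI[of _ "\<lambda>_. 0"]) simp
next
  case (insert i I)
  then show ?case using lin_span_lincomb[of "f i" m b _ "c i" 1] by simp
qed

lemma pod_space_lincomb:
  assumes "pod_space ip N \<phi> r S" "f \<in> S" "g \<in> S"
  shows "(\<lambda>x. a *\<^sub>R f x + b *\<^sub>R g x) \<in> S"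
proof -
  obtain \<nu> v where "S = lin_span r (pod_mode N \<phi> \<nu> v)" using assms(1) by (auto simp: pod_space_def)
  then show ?thesis using assms(2,3) by (simp only: lin_span_lincomb)
qed

text \<open>Modes are combinations of snapshots, so zero trace passes from the high-fidelity spaces
  to the reduced ones.\<close>

lemma pod_space_subset:
  assumes "pod_space ip N \<phi> r S" "fin_dim_space V" "\<And>n. n \<le> N \<Longrightarrow> \<phi> n \<in> V"
  shows "S \<subseteq> V"
proof -
  obtain m b where V: "V = lin_span m b" using assms(2) by (auto simp: fin_dim_space_def)
  obtain \<nu> v where S: "S = lin_span r (pod_mode N \<phi> \<nu> v)" using assms(1) by (auto simp: pod_space_def)
  have "pod_mode N \<phi> \<nu> v k \<in> V" for k
  proof -
    have "(\<lambda>x. \<Sum>\<beta>\<le>N. v k \<beta> *\<^sub>R \<phi> \<beta> x) \<in> V"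
      unfolding V by (rule lin_span_sum) (use assms(3) in \<open>simp_all add: V\<close>)
    \<comment> \<open>Scaling is obtained as a combination of the function with itself, the second
      coefficient being 0.\<close>
    from lin_span_lincomb[OF this[unfolded V] this[unfolded V], of "1 / sqrt (\<nu> k)" 0] show ?thesis
      by (simp add: V pod_mode_def)
  qed
  then have modes: "(\<lambda>x. \<Sum>k<r. c k *\<^sub>R pod_mode N \<phi> \<nu> v k x) \<in> V" for c
    unfolding V by (intro lin_span_sum) simp_all
  show ?thesis
    unfolding S lin_span_def[of r] using modes by blast
qed

theorem theorem4p1:
  fixes \<Omega> :: "(real^'d) set"
    and P :: "'d thermo_poro"
    and \<mu>0 \<mu>1 kmin kmax dmin dmax \<delta> :: real
    and N n ru rp r\<theta> :: nat
    and Vh Vr :: "(real^'d \<Rightarrow> real^'d) set"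
    and Wh Thh Wr Thr :: "(real^'d \<Rightarrow> real) set"
    and uh ur u :: "nat \<Rightarrow> real^'d \<Rightarrow> real^'d"
    and ph \<theta>h pr \<theta>r p \<theta> :: "nat \<Rightarrow> real^'d \<Rightarrow> real"
  assumes "CARD('d) = 2 \<or> CARD('d) = 3"
    and "bounded_lipschitz_domain \<Omega>"
    \<comment> \<open>parameters and data\<close>
    and "0 < \<mu>0" and "\<mu>0 < \<mu>1" and "\<mu>0 \<le> mu P" and "mu P \<le> \<mu>1" and "0 \<le> lam P"
    and "0 \<le> alpha_m P" and "0 < theta0 P" and "0 < stab_L P"
    and "elliptic_tensor \<Omega> (perm P) kmin kmax"
    and "elliptic_tensor \<Omega> (cond P) dmin dmax"
    and "0 < dt P"
    and "\<And>m. \<lbrakk>1 \<le> m; m \<le> N\<rbrakk> \<Longrightarrow> body_force P (grid_time P m) \<in> L2 \<Omega> \<and>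
           fluid_src P (grid_time P m) \<in> L2 \<Omega> \<and> heat_src P (grid_time P m) \<in> L2 \<Omega>"
    \<comment> \<open>high-fidelity spaces and run\<close>
    and "fin_dim_space Vh" and "fin_dim_space Wh" and "fin_dim_space Thh"
    and "Vh \<subseteq> H10v \<Omega>" and "Wh \<subseteq> H10 \<Omega>" and "Thh \<subseteq> H10 \<Omega>"
    and "fs_hf \<Omega> P Vh Wh Thh N uh ph \<theta>h"
    \<comment> \<open>reduced basis spaces\<close>
    and "ru \<le> N" and "rp \<le> N" and "r\<theta> \<le> N"
    and "pod_space (h1v_inner \<Omega>) N uh ru Vr"
    and "pod_space (h1_inner \<Omega>) N ph rp Wr"
    and "pod_space (h1_inner \<Omega>) N \<theta>h r\<theta> Thr"
    \<comment> \<open>hypotheses on the coefficients\<close>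
    and "storage_c0 P > 3 * alpha_m P"
    and "heat_C P > 3 * alpha_m P * theta0 P"
    and "\<delta> \<ge> 1/2" and "stab_L P \<ge> 2 * \<delta>"
    \<comment> \<open>M-ROM and FS-ROM at step \<open>n + 1\<close>\<close>
    and "n < N"
    and "monolithic_step \<Omega> P Vr Wr Thr (grid_time P (Suc n))
           (ur n) (pr n) (\<theta>r n) (ur (Suc n)) (pr (Suc n)) (\<theta>r (Suc n))"
    and "fixed_stress \<Omega> P Vr Wr Thr (grid_time P (Suc n)) (ur n) (pr n) (\<theta>r n) u p \<theta>"
    and "u 0 = ur n" and "p 0 = pr n" and "\<theta> 0 = \<theta>r n"
  shows "((\<lambda>i. h1v_norm \<Omega> (\<lambda>x. u i x - ur (Suc n) x)) \<longlonglongrightarrow> 0) \<and>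
         ((\<lambda>i. l2_norm \<Omega> (\<lambda>x. p i x - pr (Suc n) x)) \<longlonglongrightarrow> 0) \<and>
         ((\<lambda>i. l2_norm \<Omega> (\<lambda>x. \<theta> i x - \<theta>r (Suc n) x)) \<longlonglongrightarrow> 0)"
proof -
  have dom: "open \<Omega>" "bounded \<Omega>"
    using assms by (auto simp: bounded_lipschitz_domain_def)
  have hf: "\<And>k. k \<le> N \<Longrightarrow> uh k \<in> Vh" "\<And>k. k \<le> N \<Longrightarrow> ph k \<in> Wh" "\<And>k. k \<le> N \<Longrightarrow> \<theta>h k \<in> Thh"
    using \<open>fs_hf \<Omega> P Vh Wh Thh N uh ph \<theta>h\<close> by (auto simp: fs_hf_def)
  note pod = \<open>pod_space (h1v_inner \<Omega>) N uh ru Vr\<close> \<open>pod_space (h1_inner \<Omega>) N ph rp Wr\<close>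
    \<open>pod_space (h1_inner \<Omega>) N \<theta>h r\<theta> Thr\<close>
  have sub: "Vr \<subseteq> H10v \<Omega>" "Wr \<subseteq> H10 \<Omega>" "Thr \<subseteq> H10 \<Omega>"
    using pod_space_subset[OF pod(1) \<open>fin_dim_space Vh\<close> hf(1)] \<open>Vh \<subseteq> H10v \<Omega>\<close>
      pod_space_subset[OF pod(2) \<open>fin_dim_space Wh\<close> hf(2)] \<open>Wh \<subseteq> H10 \<Omega>\<close>
      pod_space_subset[OF pod(3) \<open>fin_dim_space Thh\<close> hf(3)] \<open>Thh \<subseteq> H10 \<Omega>\<close>
    by blast+
  \<comment> \<open>L >= 2 \<delta> and \<delta> >= 1/2 enter as L >= 1.\<close>
  have par: "0 < mu P" "1 \<le> stab_L P"
    using \<open>0 < \<mu>0\<close> \<open>\<mu>0 \<le> mu P\<close> \<open>\<delta> \<ge> 1/2\<close> \<open>stab_L P \<ge> 2 * \<delta>\<close> by linarith+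
  note conv = fixed_stress_tendsto_monolithic[OF dom par(1) \<open>0 \<le> lam P\<close> \<open>0 \<le> alpha_m P\<close> \<open>0 < theta0 P\<close> par(2)
      \<open>0 < dt P\<close> \<open>storage_c0 P > 3 * alpha_m P\<close> \<open>heat_C P > 3 * alpha_m P * theta0 P\<close>
      \<open>elliptic_tensor \<Omega> (perm P) kmin kmax\<close> \<open>elliptic_tensor \<Omega> (cond P) dmin dmax\<close> sub
      pod_space_lincomb[OF pod(1)] pod_space_lincomb[OF pod(2)] pod_space_lincomb[OF pod(3)]
      \<open>monolithic_step \<Omega> P Vr Wr Thr _ _ _ _ _ _ _\<close> \<open>fixed_stress \<Omega> P Vr Wr Thr _ _ _ _ _ _ _\<close>]
  show ?thesis by (intro conjI conv)
qed

end
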